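(* Let $G=(V,E)$ be a finite simple graph with $|V|>4$. If $G$ is not a complete graph, then the graph Lie algebra $\mathfrak{g}(2,G)$ over $\mathbb{C}$ is not $2$-rigid.
   Context: All Lie algebras are finite dimensional over $\mathbb{C}$. Graph Lie algebras. For a Lie algebra $\mathfrak{g}$ put $\mathfrak{g}^1=\mathfrak{g}$, $\mathfrak{g}^{i+1}=[\mathfrak{g},\mathfrak{g}^i]$. $\mathfrak{g}$ is at most $2$-step nilpotent if $\mathfrak{g}^{3}=0$. Let $G=(V,E)$ be a simple graph with vertices $V=\{v_1,\dots,v_m\}$ and edge set $E$, a set of two-element subsets of $V$. Let $L_{(2)}(m)$ be the free $2$-step nilpotent Lie algebra on the generators $v_1,\dots,v_m$ (the quotient of the free Lie algebra $L$ on $v_1,\dots,v_m$ by $L^{3}$), and let $I$ be the ideal of $L_{(2)}(m)$ generated by the brackets $[v_i,v_j]$ with $i\ne j$ and $\{v_i,v_j\}\notin E$. The $2$-step nilpotent Lie algebra associated with $G$ is $\mathfrak{g}(2,G)=L_{(2)}(m)/I$. (If $G$ has no edges, $\mathfrak{g}(2,G)$ is abelian; this case is allowed.) Rigidity. Let $\mathcal{N}_{n,2}$ be the algebraic variety of all Lie brackets $\mu$ on $\mathbb{C}^n$ such that $(\mathbb{C}^n,\mu)$ is at most $2$-step nilpotent. The group $GL(n,\mathbb{C})$ acts on it by $g\cdot\mu(x,y)=g\,\mu(g^{-1}x,g^{-1}y)$, and the orbit $\mathcal{O}(\mu)$ is the isomorphism class of $\mu$. A bracket $\mu\in\mathcal{N}_{n,2}$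 (or the corresponding Lie algebra of dimension $n$) is called $2$-rigid if $\mathcal{O}(\mu)$ is Zariski open in $\mathcal{N}_{n,2}$. *)

theory Defs
  imports
    "Jordan_Normal_Form.VS_Connect"
    "HOL-Algebra.QuotRing"
    "HOL-Library.Poly_Mapping"
    "HOL-Library.Ramsey"
begin

section \<open>Complex algebras and Lie algebras\<close>

text \<open>
  A (not necessarily associative or unital) complex algebra is a module record over the field
  of complex numbers. Its product, for a Lie algebra the bracket, is the component
  \<^const>\<open>mult\<close>, written with the symbol \<open>\<otimes>\<close>; the component \<^const>\<open>one\<close> carries no information.
\<close>

abbreviation complex_field :: "complex ring" where
  "complex_field \<equiv> class_ring"

locale complex_algebra = vectorspace complex_field A
  for A :: "(complex, 'a) module" +
  assumes mult_closed:
      "\<lbrakk>x \<in> carrier A; y \<in> carrier A\<rbrakk> \<Longrightarrow> x \<otimes>\<^bsub>A\<^esub> y \<in> carrier A"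
    and mult_add_left:
      "\<lbrakk>x \<in> carrier A; y \<in> carrier A; z \<in> carrier A\<rbrakk> \<Longrightarrow>
        (x \<oplus>\<^bsub>A\<^esub> y) \<otimes>\<^bsub>A\<^esub> z = (x \<otimes>\<^bsub>A\<^esub> z) \<oplus>\<^bsub>A\<^esub> (y \<otimes>\<^bsub>A\<^esub> z)"
    and mult_add_right:
      "\<lbrakk>x \<in> carrier A; y \<in> carrier A; z \<in> carrier A\<rbrakk> \<Longrightarrow>
        x \<otimes>\<^bsub>A\<^esub> (y \<oplus>\<^bsub>A\<^esub> z) = (x \<otimes>\<^bsub>A\<^esub> y) \<oplus>\<^bsub>A\<^esub> (x \<otimes>\<^bsub>A\<^esub> z)"
    and mult_smult_left:
      "\<lbrakk>x \<in> carrier A; y \<in> carrier A\<rbrakk> \<Longrightarrow>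
        (c \<odot>\<^bsub>A\<^esub> x) \<otimes>\<^bsub>A\<^esub> y = c \<odot>\<^bsub>A\<^esub> (x \<otimes>\<^bsub>A\<^esub> y)"
    and mult_smult_right:
      "\<lbrakk>x \<in> carrier A; y \<in> carrier A\<rbrakk> \<Longrightarrow>
        x \<otimes>\<^bsub>A\<^esub> (c \<odot>\<^bsub>A\<^esub> y) = c \<odot>\<^bsub>A\<^esub> (x \<otimes>\<^bsub>A\<^esub> y)"

definition jacobiator :: "(complex, 'a) module \<Rightarrow> 'a \<Rightarrow> 'a \<Rightarrow> 'a \<Rightarrow> 'a" where
  "jacobiator A x y z =
    (x \<otimes>\<^bsub>A\<^esub> (y \<otimes>\<^bsub>A\<^esub> z)) \<oplus>\<^bsub>A\<^esub> (y \<otimes>\<^bsub>A\<^esub> (z \<otimes>\<^bsub>A\<^esub> x)) \<oplus>\<^bsub>A\<^esub> (z \<otimes>\<^bsub>A\<^esub> (x \<otimes>\<^bsub>A\<^esub> y))"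

locale lie_algebra = complex_algebra L
  for L :: "(complex, 'a) module" +
  assumes bracket_self: "x \<in> carrier L \<Longrightarrow> x \<otimes>\<^bsub>L\<^esub> x = \<zero>\<^bsub>L\<^esub>"
    and jacobi:
      "\<lbrakk>x \<in> carrier L; y \<in> carrier L; z \<in> carrier L\<rbrakk> \<Longrightarrow> jacobiator L x y z = \<zero>\<^bsub>L\<^esub>"

definition algebra_isomorphic :: "(complex, 'a) module \<Rightarrow> (complex, 'b) module \<Rightarrow> bool" where
  "algebra_isomorphic A B \<longleftrightarrow>
    (\<exists>f \<in> LinearCombinations.module_hom complex_field A B. bij_betw f (carrier A) (carrier B) \<and>
      (\<forall>x \<in> carrier A. \<forall>y \<in> carrier A. f (x \<otimes>\<^bsub>A\<^esub> y) = f x \<otimes>\<^bsub>B\<^esub> f y))"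

definition algebra_ideal :: "'a set \<Rightarrow> (complex, 'a) module \<Rightarrow> bool" where
  "algebra_ideal I A \<longleftrightarrow> VectorSpace.subspace complex_field I A \<and>
    (\<forall>x \<in> carrier A. \<forall>a \<in> I. x \<otimes>\<^bsub>A\<^esub> a \<in> I \<and> a \<otimes>\<^bsub>A\<^esub> x \<in> I)"

definition generated_ideal :: "(complex, 'a) module \<Rightarrow> 'a set \<Rightarrow> 'a set" where
  "generated_ideal A S = \<Inter> {I. algebra_ideal I A \<and> S \<subseteq> I}"

text \<open>The ring quotient \<open>A Quot I\<close> provides the cosets with their sum and product.\<close>

definition quotient_algebra :: "(complex, 'a) module \<Rightarrow> 'a set \<Rightarrow> (complex, 'a set) module" where
  "quotient_algebra A I =
    ring.extend (A Quot I) (module.fields (\<lambda>c X. \<Union>x\<in>X. I +>\<^bsub>A\<^esub> (c \<odot>\<^bsub>A\<^esub> x)))"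

text \<open>
  The index is that of the usual convention \<open>g\<^sup>1 = g\<close>, \<open>g\<^sup>i\<^sup>+\<^sup>1 = [g, g\<^sup>i]\<close>; the value at \<open>0\<close> is an
  unused dummy.
\<close>

fun lower_central_series :: "(complex, 'a) module \<Rightarrow> nat \<Rightarrow> 'a set" where
  "lower_central_series L 0 = carrier L"
| "lower_central_series L (Suc 0) = carrier L"
| "lower_central_series L (Suc (Suc i)) =
    LinearCombinations.module.span complex_field L
      {x \<otimes>\<^bsub>L\<^esub> y | x y. x \<in> carrier L \<and> y \<in> lower_central_series L (Suc i)}"

definition at_most_2_step_nilpotent :: "(complex, 'a) module \<Rightarrow> bool" where
  "at_most_2_step_nilpotent L \<longleftrightarrow> lower_central_series L 3 = {\<zero>\<^bsub>L\<^esub>}"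


section \<open>Graph Lie algebras\<close>

text \<open>
  The free Lie algebra on \<open>V\<close> is the free non-associative algebra on \<open>V\<close> modulo the ideal
  generated by all squares and all Jacobi expressions. A basis of the former is the free
  magma on \<open>V\<close>.
\<close>

datatype 'v magma = Gen 'v | Mul "'v magma" "'v magma"

definition free_algebra :: "'v set \<Rightarrow> (complex, 'v magma \<Rightarrow>\<^sub>0 complex) module" where
  "free_algebra V = \<lparr>
    carrier = {f. \<forall>w \<in> Poly_Mapping.keys f. set_magma w \<subseteq> V},
    mult = (\<lambda>f g. \<Sum>u\<in>Poly_Mapping.keys f. \<Sum>w\<in>Poly_Mapping.keys g.
      Poly_Mapping.single (Mul u w) (Poly_Mapping.lookup f u * Poly_Mapping.lookup g w)),
    one = undefined,
    zero = 0,
    add = (+),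
    smult = (\<lambda>c. Poly_Mapping.map ((*) c))\<rparr>"

definition lie_relations :: "(complex, 'a) module \<Rightarrow> 'a set" where
  "lie_relations A =
    {x \<otimes>\<^bsub>A\<^esub> x | x. x \<in> carrier A} \<union>
    {jacobiator A x y z | x y z. x \<in> carrier A \<and> y \<in> carrier A \<and> z \<in> carrier A}"

definition lie_ideal :: "'v set \<Rightarrow> ('v magma \<Rightarrow>\<^sub>0 complex) set" where
  "lie_ideal V = generated_ideal (free_algebra V) (lie_relations (free_algebra V))"

definition free_lie :: "'v set \<Rightarrow> (complex, ('v magma \<Rightarrow>\<^sub>0 complex) set) module" where
  "free_lie V = quotient_algebra (free_algebra V) (lie_ideal V)"

definition free_lie_gen :: "'v set \<Rightarrow> 'v \<Rightarrow> ('v magma \<Rightarrow>\<^sub>0 complex) set" where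
  "free_lie_gen V v = lie_ideal V +>\<^bsub>free_algebra V\<^esub> Poly_Mapping.single (Gen v) 1"

definition free_2_step ::
    "'v set \<Rightarrow> (complex, ('v magma \<Rightarrow>\<^sub>0 complex) set set) module" where
  "free_2_step V = quotient_algebra (free_lie V) (lower_central_series (free_lie V) 3)"

definition free_2_step_gen :: "'v set \<Rightarrow> 'v \<Rightarrow> ('v magma \<Rightarrow>\<^sub>0 complex) set set" where
  "free_2_step_gen V v = lower_central_series (free_lie V) 3 +>\<^bsub>free_lie V\<^esub> free_lie_gen V v"

definition simple_graph :: "'v set \<Rightarrow> 'v set set \<Rightarrow> bool" where
  "simple_graph V E \<longleftrightarrow> finite V \<and> E \<subseteq> nsets V 2"

definition complete_graph :: "'v set \<Rightarrow> 'v set set \<Rightarrow> bool" where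
  "complete_graph V E \<longleftrightarrow> E = nsets V 2"

definition nonedge_ideal :: "'v set \<Rightarrow> 'v set set \<Rightarrow> ('v magma \<Rightarrow>\<^sub>0 complex) set set set" where
  "nonedge_ideal V E = generated_ideal (free_2_step V)
    {free_2_step_gen V v \<otimes>\<^bsub>free_2_step V\<^esub> free_2_step_gen V w | v w.
      v \<in> V \<and> w \<in> V \<and> v \<noteq> w \<and> {v, w} \<notin> E}"

definition graph_lie_algebra ::
    "'v set \<Rightarrow> 'v set set \<Rightarrow> (complex, ('v magma \<Rightarrow>\<^sub>0 complex) set set set) module" where
  "graph_lie_algebra V E = quotient_algebra (free_2_step V) (nonedge_ideal V E)"


section \<open>The variety of brackets and rigidity\<close>

type_synonym bracket = "complex vec \<Rightarrow> complex vec \<Rightarrow> complex vec"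

definition bracket_algebra :: "nat \<Rightarrow> bracket \<Rightarrow> (complex, complex vec) module" where
  "bracket_algebra n \<mu> = (module_vec TYPE(complex) n)\<lparr>mult := \<mu>\<rparr>"

text \<open>
  A bracket lives on \<^term>\<open>carrier_vec n\<close> only; extensionality makes brackets that agree there
  equal as HOL functions.
\<close>

definition nilpotent_brackets :: "nat \<Rightarrow> bracket set" where
  "nilpotent_brackets n =
    {\<mu> \<in> carrier_vec n \<rightarrow>\<^sub>E carrier_vec n \<rightarrow>\<^sub>E carrier_vec n.
      lie_algebra (bracket_algebra n \<mu>) \<and> at_most_2_step_nilpotent (bracket_algebra n \<mu>)}"

abbreviation complex_mat_ring :: "nat \<Rightarrow> complex mat ring" where
  "complex_mat_ring n \<equiv> ring_mat TYPE(complex) n ()"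

definition general_linear :: "nat \<Rightarrow> complex mat set" where
  "general_linear n = Units (complex_mat_ring n)"

definition gl_action :: "nat \<Rightarrow> complex mat \<Rightarrow> bracket \<Rightarrow> bracket" where
  "gl_action n g \<mu> = (\<lambda>x\<in>carrier_vec n. \<lambda>y\<in>carrier_vec n.
    g *\<^sub>v \<mu> (inv\<^bsub>complex_mat_ring n\<^esub> g *\<^sub>v x) (inv\<^bsub>complex_mat_ring n\<^esub> g *\<^sub>v y))"

definition bracket_orbit :: "nat \<Rightarrow> bracket \<Rightarrow> bracket set" where
  "bracket_orbit n \<mu> = (\<lambda>g. gl_action n g \<mu>) ` general_linear n"

text \<open>Polynomial functions of the structure constants of a bracket on the standard basis.\<close>

inductive_set bracket_polynomials :: "nat \<Rightarrow> (bracket \<Rightarrow> complex) set" for n :: nat where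
  const: "(\<lambda>\<mu>. c) \<in> bracket_polynomials n"
| coord: "\<lbrakk>i < n; j < n; k < n\<rbrakk> \<Longrightarrow>
    (\<lambda>\<mu>. \<mu> (unit_vec n i) (unit_vec n j) $ k) \<in> bracket_polynomials n"
| add: "\<lbrakk>p \<in> bracket_polynomials n; q \<in> bracket_polynomials n\<rbrakk> \<Longrightarrow>
    (\<lambda>\<mu>. p \<mu> + q \<mu>) \<in> bracket_polynomials n"
| mult: "\<lbrakk>p \<in> bracket_polynomials n; q \<in> bracket_polynomials n\<rbrakk> \<Longrightarrow>
    (\<lambda>\<mu>. p \<mu> * q \<mu>) \<in> bracket_polynomials n"

text \<open>Openness in the subspace topology that the variety inherits from affine space.\<close>

definition zariski_open_in_variety :: "nat \<Rightarrow> bracket set \<Rightarrow> bool" where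
  "zariski_open_in_variety n U \<longleftrightarrow>
    (\<exists>P \<subseteq> bracket_polynomials n.
      U = nilpotent_brackets n - {\<mu>. \<forall>p\<in>P. p \<mu> = 0})"

definition two_rigid_bracket :: "nat \<Rightarrow> bracket \<Rightarrow> bool" where
  "two_rigid_bracket n \<mu> \<longleftrightarrow>
    \<mu> \<in> nilpotent_brackets n \<and> zariski_open_in_variety n (bracket_orbit n \<mu>)"

text \<open>
  An abstract Lie algebra is rigid if it corresponds to a rigid bracket. Since the brackets
  isomorphic to it form a single orbit, the choice of the bracket is immaterial.
\<close>

definition two_rigid :: "(complex, 'a) module \<Rightarrow> bool" where
  "two_rigid L \<longleftrightarrow>
    (\<exists>n \<mu>. algebra_isomorphic (bracket_algebra n \<mu>) L \<and> two_rigid_bracket n \<mu>)"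

end

theory Submission
  imports Defs
begin

text \<open>
  Let \<open>ab\<close> be a non-edge. If \<open>G\<close> has an edge then, since there are more than four vertices, some
  edge \<open>cd\<close> is disjoint from some non-edge \<open>ab\<close>, and the bracket deforms by \<open>[a, b] = t [c, d]\<close>;
  otherwise it deforms by \<open>[a, b] = t v\<close> with a third vertex \<open>v\<close>. In \<open>g(2, G)\<close> the elements whose
  adjoint map has rank at most \<open>deg a\<close> include all vertices of degree at most \<open>deg a\<close> and the
  derived algebra. For \<open>t \<noteq> 0\<close> every element with a nonzero coefficient at \<open>a\<close> has adjoint rank
  greater than \<open>deg a\<close>, and so has every element with a nonzero coefficient at a vertex of degree
  greater than \<open>deg a\<close>. Hence the span of the elements of rank at most \<open>deg a\<close> drops in dimension
  and the deformed algebra is not isomorphic to \<open>g(2, G)\<close>. A polynomial that does not vanish at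
  the given bracket does not vanish at almost all points of the line of deformed brackets, so the
  orbit is not open.
\<close>

section \<open>Homomorphisms and quotients of algebras\<close>

text \<open>Not every deformation of [a, b] changes the isomorphism class: for [a, b] = t [a, d] the
  element b - t d commutes with a, and a change of basis may undo the deformation. Disjointness of
  ab and cd excludes this, because the coefficient of [c, d] in [p, b] is then t times the
  coefficient of p at a and nothing else. Five vertices guarantee such a pair; in the 4-cycle every
  edge meets every non-edge. Without edges no bracket can be the target, but every vertex is
  isolated and a third one can serve.

  The threshold deg a is the rank of the adjoint map of a at t = 0. Elements of bounded rank do not
  form a subspace in general, hence the passage to spans.

  Ranks cannot be read off from a threefold quotient of a free algebra. The graph Lie algebra is
  therefore replaced by vectors with one coordinate for each vertex and each edge. All deformed
  algebras live on this same vector space, which makes the family a line.\<close>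

definition alg_hom :: "(complex, 'a) module \<Rightarrow> (complex, 'b) module \<Rightarrow> ('a \<Rightarrow> 'b) set" where
  "alg_hom A B = {f \<in> LinearCombinations.module_hom complex_field A B.
     \<forall>x \<in> carrier A. \<forall>y \<in> carrier A. f (x \<otimes>\<^bsub>A\<^esub> y) = f x \<otimes>\<^bsub>B\<^esub> f y}"

lemma alg_homI:
  assumes "\<And>x. x \<in> carrier A \<Longrightarrow> f x \<in> carrier B"
    and "\<And>x y. \<lbrakk>x \<in> carrier A; y \<in> carrier A\<rbrakk> \<Longrightarrow> f (x \<oplus>\<^bsub>A\<^esub> y) = f x \<oplus>\<^bsub>B\<^esub> f y"
    and "\<And>c x. x \<in> carrier A \<Longrightarrow> f (c \<odot>\<^bsub>A\<^esub> x) = c \<odot>\<^bsub>B\<^esub> f x"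
    and "\<And>x y. \<lbrakk>x \<in> carrier A; y \<in> carrier A\<rbrakk> \<Longrightarrow> f (x \<otimes>\<^bsub>A\<^esub> y) = f x \<otimes>\<^bsub>B\<^esub> f y"
  shows "f \<in> alg_hom A B"
  using assms by (auto simp: alg_hom_def LinearCombinations.module_hom_def)

lemma alg_hom_simps:
  assumes "f \<in> alg_hom A B"
  shows alg_hom_closed: "x \<in> carrier A \<Longrightarrow> f x \<in> carrier B"
    and alg_hom_add: "\<lbrakk>x \<in> carrier A; y \<in> carrier A\<rbrakk> \<Longrightarrow> f (x \<oplus>\<^bsub>A\<^esub> y) = f x \<oplus>\<^bsub>B\<^esub> f y"
    and alg_hom_smult: "x \<in> carrier A \<Longrightarrow> f (c \<odot>\<^bsub>A\<^esub> x) = c \<odot>\<^bsub>B\<^esub> f x"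
    and alg_hom_mult: "\<lbrakk>x \<in> carrier A; y \<in> carrier A\<rbrakk> \<Longrightarrow> f (x \<otimes>\<^bsub>A\<^esub> y) = f x \<otimes>\<^bsub>B\<^esub> f y"
  using assms by (auto simp: alg_hom_def LinearCombinations.module_hom_def)

lemma algebra_isomorphic_iff:
  "algebra_isomorphic A B \<longleftrightarrow> (\<exists>f \<in> alg_hom A B. bij_betw f (carrier A) (carrier B))"
  by (auto simp: algebra_isomorphic_def alg_hom_def)

lemma alg_hom_comp:
  "\<lbrakk>f \<in> alg_hom A B; g \<in> alg_hom B C\<rbrakk> \<Longrightarrow> g \<circ> f \<in> alg_hom A C"
  by (rule alg_homI) (simp_all add: alg_hom_simps)

lemma algebra_isomorphic_trans:
  assumes "algebra_isomorphic A B" "algebra_isomorphic B C"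
  shows "algebra_isomorphic A C"
  using assms unfolding algebra_isomorphic_iff by (meson alg_hom_comp bij_betw_trans)

text \<open>The records used as algebras have no negation component; the law for scaling by -1
  supplies the additive inverses of the underlying group.\<close>

lemma complex_algebraI:
  fixes A :: "(complex, 'a) module"
  assumes "\<And>x y. \<lbrakk>x \<in> carrier A; y \<in> carrier A\<rbrakk> \<Longrightarrow> x \<oplus>\<^bsub>A\<^esub> y \<in> carrier A"
    and "\<zero>\<^bsub>A\<^esub> \<in> carrier A"
    and "\<And>x y z. \<lbrakk>x \<in> carrier A; y \<in> carrier A; z \<in> carrier A\<rbrakk> \<Longrightarrow>
      (x \<oplus>\<^bsub>A\<^esub> y) \<oplus>\<^bsub>A\<^esub> z = x \<oplus>\<^bsub>A\<^esub> (y \<oplus>\<^bsub>A\<^esub> z)"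
    and "\<And>x y. \<lbrakk>x \<in> carrier A; y \<in> carrier A\<rbrakk> \<Longrightarrow> x \<oplus>\<^bsub>A\<^esub> y = y \<oplus>\<^bsub>A\<^esub> x"
    and "\<And>x. x \<in> carrier A \<Longrightarrow> \<zero>\<^bsub>A\<^esub> \<oplus>\<^bsub>A\<^esub> x = x"
    and "\<And>x. x \<in> carrier A \<Longrightarrow> (- 1) \<odot>\<^bsub>A\<^esub> x \<oplus>\<^bsub>A\<^esub> x = \<zero>\<^bsub>A\<^esub>"
    and "\<And>c x. x \<in> carrier A \<Longrightarrow> c \<odot>\<^bsub>A\<^esub> x \<in> carrier A"
    and "\<And>c d x. x \<in> carrier A \<Longrightarrow> (c + d) \<odot>\<^bsub>A\<^esub> x = c \<odot>\<^bsub>A\<^esub> x \<oplus>\<^bsub>A\<^esub> d \<odot>\<^bsub>A\<^esub> x"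
    and "\<And>c x y. \<lbrakk>x \<in> carrier A; y \<in> carrier A\<rbrakk> \<Longrightarrow>
      c \<odot>\<^bsub>A\<^esub> (x \<oplus>\<^bsub>A\<^esub> y) = c \<odot>\<^bsub>A\<^esub> x \<oplus>\<^bsub>A\<^esub> c \<odot>\<^bsub>A\<^esub> y"
    and "\<And>c d x. x \<in> carrier A \<Longrightarrow> (c * d) \<odot>\<^bsub>A\<^esub> x = c \<odot>\<^bsub>A\<^esub> (d \<odot>\<^bsub>A\<^esub> x)"
    and "\<And>x. x \<in> carrier A \<Longrightarrow> 1 \<odot>\<^bsub>A\<^esub> x = x"
    and "\<And>x y. \<lbrakk>x \<in> carrier A; y \<in> carrier A\<rbrakk> \<Longrightarrow> x \<otimes>\<^bsub>A\<^esub> y \<in> carrier A"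
    and "\<And>x y z. \<lbrakk>x \<in> carrier A; y \<in> carrier A; z \<in> carrier A\<rbrakk> \<Longrightarrow>
        (x \<oplus>\<^bsub>A\<^esub> y) \<otimes>\<^bsub>A\<^esub> z = (x \<otimes>\<^bsub>A\<^esub> z) \<oplus>\<^bsub>A\<^esub> (y \<otimes>\<^bsub>A\<^esub> z)"
    and "\<And>x y z. \<lbrakk>x \<in> carrier A; y \<in> carrier A; z \<in> carrier A\<rbrakk> \<Longrightarrow>
        x \<otimes>\<^bsub>A\<^esub> (y \<oplus>\<^bsub>A\<^esub> z) = (x \<otimes>\<^bsub>A\<^esub> y) \<oplus>\<^bsub>A\<^esub> (x \<otimes>\<^bsub>A\<^esub> z)"
    and "\<And>c x y. \<lbrakk>x \<in> carrier A; y \<in> carrier A\<rbrakk> \<Longrightarrow>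
        (c \<odot>\<^bsub>A\<^esub> x) \<otimes>\<^bsub>A\<^esub> y = c \<odot>\<^bsub>A\<^esub> (x \<otimes>\<^bsub>A\<^esub> y)"
    and "\<And>c x y. \<lbrakk>x \<in> carrier A; y \<in> carrier A\<rbrakk> \<Longrightarrow>
        x \<otimes>\<^bsub>A\<^esub> (c \<odot>\<^bsub>A\<^esub> y) = c \<odot>\<^bsub>A\<^esub> (x \<otimes>\<^bsub>A\<^esub> y)"
  shows "complex_algebra A"
proof -
  have ag: "abelian_group A"
  proof (rule abelian_groupI)
    fix x assume "x \<in> carrier A"
    then show "\<exists>y\<in>carrier A. y \<oplus>\<^bsub>A\<^esub> x = \<zero>\<^bsub>A\<^esub>"
      using assms(6,7) by blast
  qed (rule assms; assumption)+
  have "Module.module complex_field A"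
  proof (rule moduleI)
    show "cring complex_field" using class_field[where 'a = complex] by (simp add: field_def domain_def)
    show "abelian_group A" by (rule ag)
  qed (unfold class_ring_simps, (rule assms; assumption)+)
  then have "vectorspace complex_field A"
    using class_field[where 'a = complex] by (simp add: vectorspace_def)
  then show ?thesis
    by (intro complex_algebra.intro complex_algebra_axioms.intro)
      (assumption | rule assms; assumption)+
qed

context complex_algebra
begin

lemma vs_axioms: "vectorspace complex_field A" ..

lemma vs_smult_closed [simp]: "x \<in> carrier A \<Longrightarrow> c \<odot>\<^bsub>A\<^esub> x \<in> carrier A"
  using smult_closed[of c x] by (simp add: class_ring_simps)

lemma smult_add: "\<lbrakk>x \<in> carrier A; y \<in> carrier A\<rbrakk> \<Longrightarrow> c \<odot>\<^bsub>A\<^esub> (x \<oplus>\<^bsub>A\<^esub> y) = c \<odot>\<^bsub>A\<^esub> x \<oplus>\<^bsub>A\<^esub> c \<odot>\<^bsub>A\<^esub> y"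
  using smult_r_distr[of c x y] by (simp add: class_ring_simps)

lemma add_smult: "x \<in> carrier A \<Longrightarrow> (c + d) \<odot>\<^bsub>A\<^esub> x = c \<odot>\<^bsub>A\<^esub> x \<oplus>\<^bsub>A\<^esub> d \<odot>\<^bsub>A\<^esub> x"
  using smult_l_distr[of c d x] by (simp add: class_ring_simps)

lemma smult_assoc: "x \<in> carrier A \<Longrightarrow> (c * d) \<odot>\<^bsub>A\<^esub> x = c \<odot>\<^bsub>A\<^esub> (d \<odot>\<^bsub>A\<^esub> x)"
  using smult_assoc1[of c d x] by (simp add: class_ring_simps)

lemma one_smult [simp]: "x \<in> carrier A \<Longrightarrow> 1 \<odot>\<^bsub>A\<^esub> x = x"
  using smult_one[of x] by (simp add: class_ring_simps)

lemma zero_smult [simp]: "x \<in> carrier A \<Longrightarrow> 0 \<odot>\<^bsub>A\<^esub> x = \<zero>\<^bsub>A\<^esub>"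
  using lmult_0[of x] by (simp add: class_ring_simps)

lemma smult_zero [simp]: "c \<odot>\<^bsub>A\<^esub> \<zero>\<^bsub>A\<^esub> = \<zero>\<^bsub>A\<^esub>"
  using rmult_0[of c] by (simp add: class_ring_simps)

lemma neg_one_smult: "x \<in> carrier A \<Longrightarrow> (- 1) \<odot>\<^bsub>A\<^esub> x = \<ominus>\<^bsub>A\<^esub> x"
proof -
  assume x: "x \<in> carrier A"
  then have "(- 1) \<odot>\<^bsub>A\<^esub> x \<oplus>\<^bsub>A\<^esub> x = \<zero>\<^bsub>A\<^esub>"
    using add_smult[of x "- 1" 1] by simp
  then have "\<ominus>\<^bsub>A\<^esub> x = (- 1) \<odot>\<^bsub>A\<^esub> x"
    using x by (intro M.minus_equality) auto
  then show ?thesis ..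
qed

lemma mult_zero_left [simp]: "x \<in> carrier A \<Longrightarrow> \<zero>\<^bsub>A\<^esub> \<otimes>\<^bsub>A\<^esub> x = \<zero>\<^bsub>A\<^esub>"
  using mult_smult_left[of "\<zero>\<^bsub>A\<^esub>" x 0] by (simp add: mult_closed)

lemma mult_zero_right [simp]: "x \<in> carrier A \<Longrightarrow> x \<otimes>\<^bsub>A\<^esub> \<zero>\<^bsub>A\<^esub> = \<zero>\<^bsub>A\<^esub>"
  using mult_smult_right[of x "\<zero>\<^bsub>A\<^esub>" 0] by (simp add: mult_closed)

lemma subspace_iff:
  "VectorSpace.subspace complex_field W A \<longleftrightarrow> W \<subseteq> carrier A \<and> \<zero>\<^bsub>A\<^esub> \<in> W \<and>
    (\<forall>x\<in>W. \<forall>y\<in>W. x \<oplus>\<^bsub>A\<^esub> y \<in> W) \<and> (\<forall>c. \<forall>x\<in>W. c \<odot>\<^bsub>A\<^esub> x \<in> W)"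
  using vs_axioms module_axioms
  by (auto simp: subspace_def submodule_def class_ring_simps)

lemma span_least:
  assumes "VectorSpace.subspace complex_field W A" "S \<subseteq> W"
  shows "span S \<subseteq> W"
  using assms by (intro span_is_subset) (simp_all add: subspace_def)

lemma span_subspace: "S \<subseteq> carrier A \<Longrightarrow> VectorSpace.subspace complex_field (span S) A"
  by (simp add: subspace_def span_is_submodule vs_axioms)

lemma algebra_idealI:
  assumes "W \<subseteq> carrier A" "\<zero>\<^bsub>A\<^esub> \<in> W" "\<And>x y. \<lbrakk>x \<in> W; y \<in> W\<rbrakk> \<Longrightarrow> x \<oplus>\<^bsub>A\<^esub> y \<in> W"
    "\<And>c x. x \<in> W \<Longrightarrow> c \<odot>\<^bsub>A\<^esub> x \<in> W"
    "\<And>x a. \<lbrakk>x \<in> carrier A; a \<in> W\<rbrakk> \<Longrightarrow> x \<otimes>\<^bsub>A\<^esub> a \<in> W"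
    "\<And>x a. \<lbrakk>x \<in> carrier A; a \<in> W\<rbrakk> \<Longrightarrow> a \<otimes>\<^bsub>A\<^esub> x \<in> W"
  shows "algebra_ideal W A"
  using assms by (simp add: algebra_ideal_def subspace_iff)

lemma algebra_ideal_carrier: "algebra_ideal (carrier A) A"
  by (rule algebra_idealI) (auto intro: mult_closed)

lemma generated_ideal_ideal:
  assumes "S \<subseteq> carrier A"
  shows "algebra_ideal (generated_ideal A S) A"
proof (rule algebra_idealI)
  show "generated_ideal A S \<subseteq> carrier A"
    using algebra_ideal_carrier assms by (auto simp: generated_ideal_def)
qed (auto simp: generated_ideal_def algebra_ideal_def subspace_iff)

lemma generated_ideal_least: "\<lbrakk>algebra_ideal I A; S \<subseteq> I\<rbrakk> \<Longrightarrow> generated_ideal A S \<subseteq> I"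
  by (auto simp: generated_ideal_def)

end

lemma generated_ideal_incl: "S \<subseteq> generated_ideal A S"
  by (auto simp: generated_ideal_def)

lemma alg_hom_zero:
  assumes "complex_algebra A" "complex_algebra B" "f \<in> alg_hom A B"
  shows "f \<zero>\<^bsub>A\<^esub> = \<zero>\<^bsub>B\<^esub>"
proof -
  interpret A: complex_algebra A by fact
  interpret B: complex_algebra B by fact
  show ?thesis
    using alg_hom_smult[OF assms(3), of "\<zero>\<^bsub>A\<^esub>" 0] alg_hom_closed[OF assms(3), of "\<zero>\<^bsub>A\<^esub>"] by simp
qed

section \<open>Kernels and quotients by ideals\<close>

definition alg_kernel :: "(complex, 'a) module \<Rightarrow> (complex, 'b) module \<Rightarrow> ('a \<Rightarrow> 'b) \<Rightarrow> 'a set" where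
  "alg_kernel A B f = {x \<in> carrier A. f x = \<zero>\<^bsub>B\<^esub>}"

lemma alg_kernel_ideal:
  assumes "complex_algebra A" "complex_algebra B" "f \<in> alg_hom A B"
  shows "algebra_ideal (alg_kernel A B f) A"
proof -
  interpret A: complex_algebra A by fact
  interpret B: complex_algebra B by fact
  show ?thesis
    by (rule A.algebra_idealI)
      (use assms in \<open>auto simp: alg_kernel_def alg_hom_zero alg_hom_simps[OF assms(3)] A.mult_closed\<close>)
qed

text \<open>Scaling and multiplication in a quotient are unions over all representatives; the union
  collapses as soon as the value is independent of them.\<close>

lemma UN_const_on: "\<lbrakk>\<And>x. x \<in> S \<Longrightarrow> f x = c; a \<in> S\<rbrakk> \<Longrightarrow> (\<Union>x\<in>S. f x) = c"
  by auto

locale algebra_with_ideal = complex_algebra A for A :: "(complex, 'a) module" +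
  fixes I :: "'a set"
  assumes ideal: "algebra_ideal I A"
begin

abbreviation Q where "Q \<equiv> quotient_algebra A I"

lemma I_subset: "I \<subseteq> carrier A"
  and I_zero: "\<zero>\<^bsub>A\<^esub> \<in> I"
  and I_add: "\<lbrakk>x \<in> I; y \<in> I\<rbrakk> \<Longrightarrow> x \<oplus>\<^bsub>A\<^esub> y \<in> I"
  and I_smult: "x \<in> I \<Longrightarrow> c \<odot>\<^bsub>A\<^esub> x \<in> I"
  and I_left: "\<lbrakk>x \<in> carrier A; y \<in> I\<rbrakk> \<Longrightarrow> x \<otimes>\<^bsub>A\<^esub> y \<in> I"
  and I_right: "\<lbrakk>x \<in> carrier A; y \<in> I\<rbrakk> \<Longrightarrow> y \<otimes>\<^bsub>A\<^esub> x \<in> I"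
  using ideal unfolding algebra_ideal_def subspace_iff by auto

lemma abelian_subgroup_I: "abelian_subgroup I A"
proof (rule abelian_subgroupI3)
  show "additive_subgroup I A"
  proof (rule additive_subgroupI, rule add.subgroupI)
    fix a assume "a \<in> I"
    then show "\<ominus>\<^bsub>A\<^esub> a \<in> I"
      using I_smult[of a "- 1"] I_subset by (auto simp: neg_one_smult)
  qed (use I_subset I_zero I_add in auto)
  show "abelian_group A" ..
qed

sublocale sub: abelian_subgroup I A by (rule abelian_subgroup_I)

lemma coset_eq_iff:
  assumes "x \<in> carrier A" "y \<in> carrier A"
  shows "I +>\<^bsub>A\<^esub> x = I +>\<^bsub>A\<^esub> y \<longleftrightarrow> x \<ominus>\<^bsub>A\<^esub> y \<in> I"
  using assms sub.a_rcos_module[of y x] sub.a_rcos_self[of x] sub.a_repr_independence'[of x y]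
  unfolding a_minus_def by metis

lemma carrier_Q: "carrier Q = (\<lambda>x. I +>\<^bsub>A\<^esub> x) ` carrier A"
  by (auto simp: quotient_algebra_def ring.defs FactRing_def A_RCOSETS_def' a_r_coset_def')

lemma zero_Q: "\<zero>\<^bsub>Q\<^esub> = I +>\<^bsub>A\<^esub> \<zero>\<^bsub>A\<^esub>"
  using sub.a_rcos_const[OF I_zero] by (simp add: quotient_algebra_def ring.defs FactRing_def)

lemma add_Q:
  "\<lbrakk>x \<in> carrier A; y \<in> carrier A\<rbrakk> \<Longrightarrow> (I +>\<^bsub>A\<^esub> x) \<oplus>\<^bsub>Q\<^esub> (I +>\<^bsub>A\<^esub> y) = I +>\<^bsub>A\<^esub> (x \<oplus>\<^bsub>A\<^esub> y)"
  using sub.a_rcos_sum by (simp add: quotient_algebra_def ring.defs FactRing_def)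

lemma coset_eqI:
  assumes "x \<in> carrier A" "y \<in> carrier A" "h \<in> I" "x = h \<oplus>\<^bsub>A\<^esub> y"
  shows "I +>\<^bsub>A\<^esub> x = I +>\<^bsub>A\<^esub> y"
  using assms I_subset by (simp add: coset_eq_iff a_minus_def M.add.m_assoc M.r_neg subset_iff)

lemma coset_memE:
  assumes "x' \<in> I +>\<^bsub>A\<^esub> x" "x \<in> carrier A"
  obtains h where "h \<in> I" "x' = h \<oplus>\<^bsub>A\<^esub> x" "x' \<in> carrier A"
  using assms I_subset by (auto simp: a_r_coset_def')

lemma smult_Q:
  assumes "x \<in> carrier A"
  shows "c \<odot>\<^bsub>Q\<^esub> (I +>\<^bsub>A\<^esub> x) = I +>\<^bsub>A\<^esub> (c \<odot>\<^bsub>A\<^esub> x)"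
proof -
  have "I +>\<^bsub>A\<^esub> (c \<odot>\<^bsub>A\<^esub> x') = I +>\<^bsub>A\<^esub> (c \<odot>\<^bsub>A\<^esub> x)" if "x' \<in> I +>\<^bsub>A\<^esub> x" for x'
  proof -
    from that assms obtain h where "h \<in> I" "x' = h \<oplus>\<^bsub>A\<^esub> x" "x' \<in> carrier A" by (rule coset_memE)
    then show ?thesis
      using assms I_subset I_smult[of h c]
      by (intro coset_eqI[where h = "c \<odot>\<^bsub>A\<^esub> h"]) (auto simp: smult_add)
  qed
  then have "(\<Union>x'\<in>I +>\<^bsub>A\<^esub> x. I +>\<^bsub>A\<^esub> (c \<odot>\<^bsub>A\<^esub> x')) = I +>\<^bsub>A\<^esub> (c \<odot>\<^bsub>A\<^esub> x)"
    using sub.a_rcos_self[OF assms] by (rule UN_const_on)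
  then show ?thesis
    by (simp add: quotient_algebra_def ring.defs module.defs)
qed

lemma mult_Q:
  assumes x: "x \<in> carrier A" and y: "y \<in> carrier A"
  shows "(I +>\<^bsub>A\<^esub> x) \<otimes>\<^bsub>Q\<^esub> (I +>\<^bsub>A\<^esub> y) = I +>\<^bsub>A\<^esub> (x \<otimes>\<^bsub>A\<^esub> y)"
proof -
  have "I +>\<^bsub>A\<^esub> (x' \<otimes>\<^bsub>A\<^esub> y') = I +>\<^bsub>A\<^esub> (x \<otimes>\<^bsub>A\<^esub> y)"
    if "x' \<in> I +>\<^bsub>A\<^esub> x" "y' \<in> I +>\<^bsub>A\<^esub> y" for x' y'
  proof -
    from that x obtain h where h: "h \<in> I" "x' = h \<oplus>\<^bsub>A\<^esub> x" "x' \<in> carrier A" by (auto elim: coset_memE)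
    from that y obtain k where k: "k \<in> I" "y' = k \<oplus>\<^bsub>A\<^esub> y" "y' \<in> carrier A" by (auto elim: coset_memE)
    have hk: "h \<in> carrier A" "k \<in> carrier A" using h k I_subset by auto
    \<comment> \<open>Expansion of (h + x)(k + y): the terms h y' and x k are absorbed by the ideal,
      one on the right and one on the left.\<close>
    have "x' \<otimes>\<^bsub>A\<^esub> y' = (h \<otimes>\<^bsub>A\<^esub> y' \<oplus>\<^bsub>A\<^esub> x \<otimes>\<^bsub>A\<^esub> k) \<oplus>\<^bsub>A\<^esub> x \<otimes>\<^bsub>A\<^esub> y"
      using h k hk x y
      by (simp add: mult_add_left mult_add_right mult_closed M.add.m_assoc M.add.m_lcomm)
    moreover have "h \<otimes>\<^bsub>A\<^esub> y' \<oplus>\<^bsub>A\<^esub> x \<otimes>\<^bsub>A\<^esub> k \<in> I"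
      using h k hk x y by (intro I_add I_left I_right)
    ultimately show ?thesis
      using x y h k by (intro coset_eqI) (auto intro: mult_closed)
  qed
  then have "(\<Union>x'\<in>I +>\<^bsub>A\<^esub> x. \<Union>y'\<in>I +>\<^bsub>A\<^esub> y. I +>\<^bsub>A\<^esub> (x' \<otimes>\<^bsub>A\<^esub> y')) = I +>\<^bsub>A\<^esub> (x \<otimes>\<^bsub>A\<^esub> y)"
    by (intro UN_const_on[OF _ sub.a_rcos_self[OF x]] UN_const_on[OF _ sub.a_rcos_self[OF y]])
  then show ?thesis
    by (simp add: quotient_algebra_def ring.defs FactRing_def rcoset_mult_def)
qed

lemma complex_algebra_Q: "complex_algebra Q"
  by (rule complex_algebraI)
    (auto simp: carrier_Q zero_Q add_Q smult_Q mult_Q mult_closed M.add.m_ac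
      add_smult smult_add smult_assoc neg_one_smult M.r_neg
      mult_add_left mult_add_right mult_smult_left mult_smult_right)

lemma coset_hom: "(\<lambda>x. I +>\<^bsub>A\<^esub> x) \<in> alg_hom A Q"
  by (rule alg_homI) (auto simp: carrier_Q add_Q smult_Q mult_Q)

lemma coset_eq_zero_iff: "x \<in> carrier A \<Longrightarrow> I +>\<^bsub>A\<^esub> x = \<zero>\<^bsub>Q\<^esub> \<longleftrightarrow> x \<in> I"
  using sub.a_rcos_const[OF I_zero] sub.a_rcos_const[of x] sub.a_rcos_self[of x] by (auto simp: zero_Q)

text \<open>Two representatives of a coset differ by an element of the kernel. The
  \<open>obtains\<close> form gives the lift by its values on cosets, so the choice of
  representatives stays inside this proof.\<close>

lemma quotient_lift:
  assumes B: "complex_algebra B" and f: "f \<in> alg_hom A B" and I: "I \<subseteq> alg_kernel A B f"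
  obtains g where "g \<in> alg_hom Q B" "\<And>x. x \<in> carrier A \<Longrightarrow> g (I +>\<^bsub>A\<^esub> x) = f x"
proof -
  interpret B: complex_algebra B by fact
  define g where "g X = f (SOME x. x \<in> X)" for X
  have g: "g (I +>\<^bsub>A\<^esub> x) = f x" if x: "x \<in> carrier A" for x
  proof -
    have "(SOME x'. x' \<in> I +>\<^bsub>A\<^esub> x) \<in> I +>\<^bsub>A\<^esub> x"
      using sub.a_rcos_self[OF x] by (rule someI)
    then obtain h where h: "h \<in> I" "(SOME x'. x' \<in> I +>\<^bsub>A\<^esub> x) = h \<oplus>\<^bsub>A\<^esub> x"
      using x by (rule coset_memE)
    then have "h \<in> carrier A" "f h = \<zero>\<^bsub>B\<^esub>" using I by (auto simp: alg_kernel_def)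
    then show ?thesis
      using h x f by (simp add: g_def alg_hom_simps[OF f])
  qed
  have "g \<in> alg_hom Q B"
    by (rule alg_homI)
      (auto simp: carrier_Q add_Q smult_Q mult_Q mult_closed g alg_hom_simps[OF f])
  then show thesis using g by (rule that)
qed

end

section \<open>Two-step nilpotency in terms of triple products\<close>

lemma lie_algebra_of_triple_zero:
  assumes "complex_algebra L"
    and "\<And>x. x \<in> carrier L \<Longrightarrow> x \<otimes>\<^bsub>L\<^esub> x = \<zero>\<^bsub>L\<^esub>"
    and "\<And>x y z. \<lbrakk>x \<in> carrier L; y \<in> carrier L; z \<in> carrier L\<rbrakk> \<Longrightarrow> x \<otimes>\<^bsub>L\<^esub> (y \<otimes>\<^bsub>L\<^esub> z) = \<zero>\<^bsub>L\<^esub>"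
  shows "lie_algebra L"
proof -
  interpret complex_algebra L by fact
  show ?thesis
    using assms by unfold_locales (auto simp: jacobiator_def)
qed

context complex_algebra
begin

text \<open>The second term of the lower central series, named so that the third is the span of the
  products with it.\<close>

definition derived :: "'a set" where
  "derived = span {x \<otimes>\<^bsub>A\<^esub> y | x y. x \<in> carrier A \<and> y \<in> carrier A}"

lemma lcs_3: "lower_central_series A 3 = span {x \<otimes>\<^bsub>A\<^esub> y | x y. x \<in> carrier A \<and> y \<in> derived}"
  by (simp add: numeral_3_eq_3 derived_def)

lemma derived_subspace: "VectorSpace.subspace complex_field derived A"
  unfolding derived_def by (rule span_subspace) (auto intro: mult_closed)

lemma mult_in_derived: "\<lbrakk>x \<in> carrier A; y \<in> carrier A\<rbrakk> \<Longrightarrow> x \<otimes>\<^bsub>A\<^esub> y \<in> derived"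
  unfolding derived_def by (rule in_own_span[THEN subsetD]) (auto intro: mult_closed)

lemma lcs_3_subspace: "VectorSpace.subspace complex_field (lower_central_series A 3) A"
  unfolding lcs_3 using derived_subspace
  by (intro span_subspace) (auto simp: subspace_iff intro!: mult_closed)

lemma mult_in_lcs_3: "\<lbrakk>x \<in> carrier A; y \<in> derived\<rbrakk> \<Longrightarrow> x \<otimes>\<^bsub>A\<^esub> y \<in> lower_central_series A 3"
  unfolding lcs_3 using derived_subspace
  by (intro in_own_span[THEN subsetD]) (auto simp: subspace_iff intro!: mult_closed)

text \<open>The elements y with x y in W for all x form a subspace, so with all products it contains
  their span. Two nested spans thus reduce to a condition on triple products.\<close>

lemma lcs_3_least:
  assumes W: "VectorSpace.subspace complex_field W A"
    and triple: "\<And>x y z. \<lbrakk>x \<in> carrier A; y \<in> carrier A; z \<in> carrier A\<rbrakk> \<Longrightarrow> x \<otimes>\<^bsub>A\<^esub> (y \<otimes>\<^bsub>A\<^esub> z) \<in> W"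
  shows "lower_central_series A 3 \<subseteq> W"
proof -
  have "derived \<subseteq> {y \<in> carrier A. \<forall>x\<in>carrier A. x \<otimes>\<^bsub>A\<^esub> y \<in> W}"
    unfolding derived_def
    by (rule span_least)
      (use W triple in \<open>auto simp: subspace_iff mult_add_right mult_smult_right mult_closed\<close>)
  then show ?thesis
    unfolding lcs_3 by (intro span_least[OF W]) auto
qed

lemma at_most_2_step_iff:
  "at_most_2_step_nilpotent A \<longleftrightarrow>
    (\<forall>x\<in>carrier A. \<forall>y\<in>carrier A. \<forall>z\<in>carrier A. x \<otimes>\<^bsub>A\<^esub> (y \<otimes>\<^bsub>A\<^esub> z) = \<zero>\<^bsub>A\<^esub>)"
proof
  assume "at_most_2_step_nilpotent A"
  then show "\<forall>x\<in>carrier A. \<forall>y\<in>carrier A. \<forall>z\<in>carrier A. x \<otimes>\<^bsub>A\<^esub> (y \<otimes>\<^bsub>A\<^esub> z) = \<zero>\<^bsub>A\<^esub>"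
    using mult_in_lcs_3 mult_in_derived by (auto simp: at_most_2_step_nilpotent_def)
next
  assume "\<forall>x\<in>carrier A. \<forall>y\<in>carrier A. \<forall>z\<in>carrier A. x \<otimes>\<^bsub>A\<^esub> (y \<otimes>\<^bsub>A\<^esub> z) = \<zero>\<^bsub>A\<^esub>"
  then have "lower_central_series A 3 \<subseteq> {\<zero>\<^bsub>A\<^esub>}"
    by (intro lcs_3_least) (auto simp: subspace_iff)
  then show "at_most_2_step_nilpotent A"
    using lcs_3_subspace by (auto simp: at_most_2_step_nilpotent_def subspace_iff)
qed

text \<open>Polarisation of the square of x + y.\<close>

lemma mult_anticomm:
  assumes "\<And>x. x \<in> carrier A \<Longrightarrow> x \<otimes>\<^bsub>A\<^esub> x = \<zero>\<^bsub>A\<^esub>" "x \<in> carrier A" "y \<in> carrier A"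
  shows "y \<otimes>\<^bsub>A\<^esub> x = (- 1) \<odot>\<^bsub>A\<^esub> (x \<otimes>\<^bsub>A\<^esub> y)"
proof -
  have "(x \<oplus>\<^bsub>A\<^esub> y) \<otimes>\<^bsub>A\<^esub> (x \<oplus>\<^bsub>A\<^esub> y) =
      (x \<otimes>\<^bsub>A\<^esub> x \<oplus>\<^bsub>A\<^esub> y \<otimes>\<^bsub>A\<^esub> x) \<oplus>\<^bsub>A\<^esub> (x \<otimes>\<^bsub>A\<^esub> y \<oplus>\<^bsub>A\<^esub> y \<otimes>\<^bsub>A\<^esub> y)"
    using assms(2,3) by (simp add: mult_add_left mult_add_right mult_closed)
  then have "y \<otimes>\<^bsub>A\<^esub> x \<oplus>\<^bsub>A\<^esub> x \<otimes>\<^bsub>A\<^esub> y = \<zero>\<^bsub>A\<^esub>"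
    using assms(2,3) by (simp add: assms(1) mult_closed)
  then have "\<ominus>\<^bsub>A\<^esub> (x \<otimes>\<^bsub>A\<^esub> y) = y \<otimes>\<^bsub>A\<^esub> x"
    using assms(2,3) by (intro M.minus_equality) (auto intro: mult_closed)
  then show ?thesis using assms(2,3) by (simp add: neg_one_smult mult_closed)
qed

text \<open>Absorption on the left holds because the third term lies inside the derived algebra;
  anticommutativity carries it over to the right.\<close>

lemma lcs_3_ideal:
  assumes "\<And>x. x \<in> carrier A \<Longrightarrow> x \<otimes>\<^bsub>A\<^esub> x = \<zero>\<^bsub>A\<^esub>"
  shows "algebra_ideal (lower_central_series A 3) A"
proof -
  have sub: "lower_central_series A 3 \<subseteq> carrier A"
    using lcs_3_subspace by (simp add: subspace_iff)
  have der: "lower_central_series A 3 \<subseteq> derived"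
    by (rule lcs_3_least) (simp_all add: derived_subspace mult_in_derived mult_closed)
  show ?thesis
    unfolding algebra_ideal_def
  proof (intro conjI ballI)
    fix x a assume x: "x \<in> carrier A" and a: "a \<in> lower_central_series A 3"
    then show 1: "x \<otimes>\<^bsub>A\<^esub> a \<in> lower_central_series A 3" using der by (auto intro: mult_in_lcs_3)
    show "a \<otimes>\<^bsub>A\<^esub> x \<in> lower_central_series A 3"
      using lcs_3_subspace 1 x a sub by (subst mult_anticomm[OF assms, of x a]) (auto simp: subspace_iff)
  qed (rule lcs_3_subspace)
qed

end

section \<open>Coordinate model of a graph Lie algebra\<close>

text \<open>The minor of x and y at the vertices v and w. Edge coordinates do not enter, which makes
  products central in the graph model.\<close>

definition wedge :: "('v + 'i \<Rightarrow> complex) \<Rightarrow> ('v + 'i \<Rightarrow> complex) \<Rightarrow> 'v \<Rightarrow> 'v \<Rightarrow> complex" where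
  "wedge x y v w = x (Inl v) * y (Inl w) - x (Inl w) * y (Inl v)"

definition graph_bracket ::
    "('v \<times> 'v) set \<Rightarrow> ('v + 'v \<times> 'v \<Rightarrow> complex) \<Rightarrow> ('v + 'v \<times> 'v \<Rightarrow> complex) \<Rightarrow>
      'v + 'v \<times> 'v \<Rightarrow> complex" where
  "graph_bracket D x y = case_sum (\<lambda>_. 0) (\<lambda>(v, w). if (v, w) \<in> D then wedge x y v w else 0)"

lemma graph_bracket_simps [simp]:
  "graph_bracket D x y (Inl v) = 0"
  "graph_bracket D x y (Inr (v, w)) = (if (v, w) \<in> D then wedge x y v w else 0)"
  by (simp_all add: graph_bracket_def)

text \<open>
  \<open>D\<close> contains each edge in one of its two orientations. The coordinate \<open>Inl v\<close> belongs to the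
  generator \<open>v\<close>, and \<open>Inr (v, w)\<close> to the bracket \<open>[v, w]\<close>.
\<close>
definition graph_model :: "'v set \<Rightarrow> ('v \<times> 'v) set \<Rightarrow> (complex, 'v + 'v \<times> 'v \<Rightarrow> complex) module" where
  "graph_model V D = \<lparr>
    carrier = {x. \<forall>i. i \<notin> V <+> D \<longrightarrow> x i = 0},
    mult = graph_bracket D,
    one = undefined,
    zero = (\<lambda>_. 0),
    add = (\<lambda>x y i. x i + y i),
    smult = (\<lambda>c x i. c * x i)\<rparr>"

text \<open>The vector z added to the bracket of a and b is left arbitrary. With z = 0 the graph
  model returns, so the algebra laws are checked once for both.\<close>

definition deformed_model ::
    "'v set \<Rightarrow> ('v \<times> 'v) set \<Rightarrow> 'v \<Rightarrow> 'v \<Rightarrow> ('v + 'v \<times> 'v \<Rightarrow> complex) \<Rightarrow>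
      (complex, 'v + 'v \<times> 'v \<Rightarrow> complex) module" where
  "deformed_model V D a b z =
    (graph_model V D)\<lparr>mult := \<lambda>x y i. graph_bracket D x y i + wedge x y a b * z i\<rparr>"

lemma deformed_model_0: "deformed_model V D a b (\<lambda>_. 0) = graph_model V D"
  by (simp add: deformed_model_def graph_model_def)

lemma deformed_model_simps:
  "carrier (deformed_model V D a b z) = {x. \<forall>i. i \<notin> V <+> D \<longrightarrow> x i = 0}"
  "x \<otimes>\<^bsub>deformed_model V D a b z\<^esub> y = (\<lambda>i. graph_bracket D x y i + wedge x y a b * z i)"
  "zero (deformed_model V D a b z) = (\<lambda>_. 0)"
  "x \<oplus>\<^bsub>deformed_model V D a b z\<^esub> y = (\<lambda>i. x i + y i)"
  "c \<odot>\<^bsub>deformed_model V D a b z\<^esub> x = (\<lambda>i. c * x i)"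
  by (simp_all add: deformed_model_def graph_model_def)

lemma graph_model_simps:
  "carrier (graph_model V D) = {x. \<forall>i. i \<notin> V <+> D \<longrightarrow> x i = 0}"
  "x \<otimes>\<^bsub>graph_model V D\<^esub> y = graph_bracket D x y"
  "zero (graph_model V D) = (\<lambda>_. 0)"
  "x \<oplus>\<^bsub>graph_model V D\<^esub> y = (\<lambda>i. x i + y i)"
  "c \<odot>\<^bsub>graph_model V D\<^esub> x = (\<lambda>i. c * x i)"
  by (simp_all add: graph_model_def)

lemma wedge_simps:
  "wedge x x v w = 0"
  "wedge (\<lambda>i. x i + x' i) y v w = wedge x y v w + wedge x' y v w"
  "wedge x (\<lambda>i. y i + y' i) v w = wedge x y v w + wedge x y' v w"
  "wedge (\<lambda>i. c * x i) y v w = c * wedge x y v w"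
  "wedge x (\<lambda>i. c * y i) v w = c * wedge x y v w"
  by (simp_all add: wedge_def algebra_simps)

lemma graph_bracket_linear:
  "graph_bracket D x x i = 0"
  "graph_bracket D (\<lambda>i. x i + x' i) y i = graph_bracket D x y i + graph_bracket D x' y i"
  "graph_bracket D x (\<lambda>i. y i + y' i) i = graph_bracket D x y i + graph_bracket D x y' i"
  "graph_bracket D (\<lambda>i. c * x i) y i = c * graph_bracket D x y i"
  "graph_bracket D x (\<lambda>i. c * y i) i = c * graph_bracket D x y i"
  by (cases i; auto simp: wedge_simps)+

lemma graph_bracket_support: "i \<notin> V <+> D \<Longrightarrow> graph_bracket D x y i = 0"
  by (cases i) (auto split: if_splits)

lemma complex_algebra_deformed:
  assumes "z \<in> carrier (graph_model V D)"
  shows "complex_algebra (deformed_model V D a b z)"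
  by (rule complex_algebraI)
    (use assms in \<open>auto simp: deformed_model_simps graph_model_simps graph_bracket_linear wedge_simps
      graph_bracket_support algebra_simps\<close>)

text \<open>A product has vertex coordinates only through z. If these avoid a, b and all endpoints
  of edges, every minor that a second multiplication uses is zero.\<close>

lemma deformed_triple_zero:
  assumes "\<And>v. z (Inl v) \<noteq> 0 \<Longrightarrow> v \<notin> {a, b} \<and> v \<notin> Field D"
  shows "x \<otimes>\<^bsub>deformed_model V D a b z\<^esub> (y \<otimes>\<^bsub>deformed_model V D a b z\<^esub> w) =
    \<zero>\<^bsub>deformed_model V D a b z\<^esub>"
proof -
  define u where "u = y \<otimes>\<^bsub>deformed_model V D a b z\<^esub> w"
  have u: "u (Inl v) = 0" if "v \<in> {a, b} \<union> Field D" for v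
    using assms[of v] that by (auto simp: u_def deformed_model_simps)
  have "wedge x u a b = 0" using u by (simp add: wedge_def)
  moreover have "wedge x u v w = 0" if "(v, w) \<in> D" for v w
    using u[of v] u[of w] that by (simp add: wedge_def FieldI1 FieldI2)
  then have "graph_bracket D x u = (\<lambda>_. 0)"
    by (auto simp: graph_bracket_def fun_eq_iff split: sum.split)
  ultimately show ?thesis by (simp add: u_def[symmetric]) (simp add: deformed_model_simps)
qed

lemma deformed_self: "x \<otimes>\<^bsub>deformed_model V D a b z\<^esub> x = \<zero>\<^bsub>deformed_model V D a b z\<^esub>"
  by (simp add: deformed_model_simps graph_bracket_linear wedge_simps)

lemma complex_algebra_model: "complex_algebra (graph_model V D)"
  using complex_algebra_deformed[where z = "\<lambda>_. 0" and V = V and D = D] by (simp add: deformed_model_0 graph_model_simps)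

lemma model_triple_zero: "graph_bracket D x (graph_bracket D y w) = (\<lambda>_. 0)"
  using deformed_triple_zero[where z = "\<lambda>_. 0" and D = D and x = x and y = y and w = w]
  by (simp add: deformed_model_0 graph_model_simps)

section \<open>The free non-associative algebra, its coordinates and normal forms\<close>

lemma free_algebra_simps:
  "carrier (free_algebra V) = {f. \<forall>w \<in> Poly_Mapping.keys f. set_magma w \<subseteq> V}"
  "zero (free_algebra V) = 0"
  "add (free_algebra V) = (+)"
  by (simp_all add: free_algebra_def)

lemma lookup_free_smult:
  "Poly_Mapping.lookup (c \<odot>\<^bsub>free_algebra V\<^esub> f) w = c * Poly_Mapping.lookup f w"
  by (simp add: free_algebra_def Poly_Mapping.map.rep_eq when_def)

lemma lookup_free_mult_Gen: "Poly_Mapping.lookup (f \<otimes>\<^bsub>free_algebra V\<^esub> g) (Gen v) = 0"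
  by (simp add: free_algebra_def lookup_sum lookup_single)

text \<open>A word of the free magma splits into two factors in only one way, so a single product
  remains of the double sum.\<close>

lemma lookup_free_mult_Mul:
  "Poly_Mapping.lookup (f \<otimes>\<^bsub>free_algebra V\<^esub> g) (Mul u w) =
    Poly_Mapping.lookup f u * Poly_Mapping.lookup g w"
proof -
  have "Poly_Mapping.lookup (f \<otimes>\<^bsub>free_algebra V\<^esub> g) (Mul u w) =
      (\<Sum>u'\<in>Poly_Mapping.keys f. \<Sum>w'\<in>Poly_Mapping.keys g.
        if u' = u then if w' = w then Poly_Mapping.lookup f u' * Poly_Mapping.lookup g w' else 0 else 0)"
    by (auto simp: free_algebra_def lookup_sum lookup_single when_def intro!: sum.cong)
  also have "\<dots> = (\<Sum>u'\<in>Poly_Mapping.keys f. if u' = u then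
      (\<Sum>w'\<in>Poly_Mapping.keys g. if w' = w then Poly_Mapping.lookup f u' * Poly_Mapping.lookup g w' else 0)
      else 0)"
    by (intro sum.cong) auto
  also have "\<dots> = Poly_Mapping.lookup f u * Poly_Mapping.lookup g w"
    by (auto simp: sum.delta in_keys_iff)
  finally show ?thesis .
qed

lemmas lookup_free = lookup_free_smult lookup_free_mult_Gen lookup_free_mult_Mul

lemma free_algebra_eqI:
  fixes f g :: "'v magma \<Rightarrow>\<^sub>0 complex"
  assumes "\<And>v. Poly_Mapping.lookup f (Gen v) = Poly_Mapping.lookup g (Gen v)"
    and "\<And>u w. Poly_Mapping.lookup f (Mul u w) = Poly_Mapping.lookup g (Mul u w)"
  shows "f = g"
proof (rule poly_mapping_eqI)
  fix w show "Poly_Mapping.lookup f w = Poly_Mapping.lookup g w"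
    by (cases w) (simp_all add: assms)
qed

lemma free_carrier_iff:
  "f \<in> carrier (free_algebra V) \<longleftrightarrow> (\<forall>w. Poly_Mapping.lookup f w \<noteq> 0 \<longrightarrow> set_magma w \<subseteq> V)"
  by (auto simp: free_algebra_simps in_keys_iff)

lemma complex_algebra_free:
  fixes V :: "'v set"
  shows "complex_algebra (free_algebra V)"
proof (rule complex_algebraI)
  fix f g :: "'v magma \<Rightarrow>\<^sub>0 complex"
  assume f: "f \<in> carrier (free_algebra V)" and g: "g \<in> carrier (free_algebra V)"
  show "f \<otimes>\<^bsub>free_algebra V\<^esub> g \<in> carrier (free_algebra V)"
    unfolding free_carrier_iff
  proof (intro allI impI)
    fix w assume "Poly_Mapping.lookup (f \<otimes>\<^bsub>free_algebra V\<^esub> g) w \<noteq> 0"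
    then show "set_magma w \<subseteq> V"
      using f g by (cases w) (auto simp: lookup_free free_carrier_iff)
  qed
  show "f \<oplus>\<^bsub>free_algebra V\<^esub> g \<in> carrier (free_algebra V)"
    using f g Poly_Mapping.keys_add[of f g] unfolding free_algebra_simps by blast
  show "c \<odot>\<^bsub>free_algebra V\<^esub> f \<in> carrier (free_algebra V)" for c
    using f by (auto simp: free_carrier_iff lookup_free)
qed (auto simp: free_carrier_iff free_algebra_simps(2,3) lookup_add lookup_free algebra_simps
  intro!: free_algebra_eqI)

text \<open>The coordinates of the image of f in the graph Lie algebra. Words of length two are
  antisymmetrised because [w, v] = - [v, w] is recorded on the chosen orientation; non-edges and
  longer words are dropped.\<close>

definition coords :: "('v \<times> 'v) set \<Rightarrow> ('v magma \<Rightarrow>\<^sub>0 complex) \<Rightarrow> 'v + 'v \<times> 'v \<Rightarrow> complex" where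
  "coords D f = case_sum (\<lambda>v. Poly_Mapping.lookup f (Gen v))
    (\<lambda>(v, w). if (v, w) \<in> D then Poly_Mapping.lookup f (Mul (Gen v) (Gen w))
      - Poly_Mapping.lookup f (Mul (Gen w) (Gen v)) else 0)"

lemma coords_simps:
  "coords D f (Inl v) = Poly_Mapping.lookup f (Gen v)"
  "coords D f (Inr (v, w)) = (if (v, w) \<in> D then Poly_Mapping.lookup f (Mul (Gen v) (Gen w))
      - Poly_Mapping.lookup f (Mul (Gen w) (Gen v)) else 0)"
  by (simp_all add: coords_def)

lemma coords_single_Mul:
  fixes D :: "('v \<times> 'v) set"
  assumes "(v, w) \<in> D" "(w, v) \<notin> D"
  shows "coords D (Poly_Mapping.single (Mul (Gen v) (Gen w)) c) = (\<lambda>i. if i = Inr (v, w) then c else 0)"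
    and "coords D (Poly_Mapping.single (Mul (Gen w) (Gen v)) c) = (\<lambda>i. if i = Inr (v, w) then - c else 0)"
proof -
  have "v \<noteq> w" using assms by auto
  have "coords D (Poly_Mapping.single (Mul (Gen v) (Gen w)) c) i = (if i = Inr (v, w) then c else 0) \<and>
    coords D (Poly_Mapping.single (Mul (Gen w) (Gen v)) c) i = (if i = Inr (v, w) then - c else 0)"
    for i :: "'v + 'v \<times> 'v"
  proof (cases i)
    case (Inr p)
    obtain x y where "p = (x, y)" by (cases p)
    then show ?thesis
      using assms \<open>v \<noteq> w\<close> Inr
      by (cases "x = v"; cases "y = w"; cases "x = w"; cases "y = v")
        (simp_all add: coords_simps lookup_single when_def)
  qed (simp add: coords_simps lookup_single)
  then show "coords D (Poly_Mapping.single (Mul (Gen v) (Gen w)) c) = (\<lambda>i. if i = Inr (v, w) then c else 0)"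
    "coords D (Poly_Mapping.single (Mul (Gen w) (Gen v)) c) = (\<lambda>i. if i = Inr (v, w) then - c else 0)"
    by blast+
qed

lemma coords_single_nonedge:
  fixes D :: "('v \<times> 'v) set"
  assumes "\<And>v w. (v, w) \<in> D \<Longrightarrow> u \<noteq> Mul (Gen v) (Gen w) \<and> u \<noteq> Mul (Gen w) (Gen v)"
    and "\<And>v. u \<noteq> Gen v"
  shows "coords D (Poly_Mapping.single u c) = (\<lambda>_. 0)"
proof
  fix i :: "'v + 'v \<times> 'v"
  show "coords D (Poly_Mapping.single u c) i = 0"
  proof (cases i)
    case (Inr p)
    then show ?thesis
      using assms(1)[of "fst p" "snd p"] by (cases p) (simp add: coords_simps lookup_single_not_eq)
  qed (simp add: coords_simps lookup_single_not_eq assms(2))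
qed

text \<open>A product has no coefficient at a generator, and its coefficient at the word vw is the
  product of those of the factors at v and w; antisymmetrising yields exactly the minor in
  \<open>graph_bracket\<close>.\<close>

lemma coords_hom: "D \<subseteq> V \<times> V \<Longrightarrow> coords D \<in> alg_hom (free_algebra V) (graph_model V D)"
proof (rule alg_homI)
  fix f assume "D \<subseteq> V \<times> V" "f \<in> carrier (free_algebra V)"
  then show "coords D f \<in> carrier (graph_model V D)"
    by (force simp: graph_model_simps coords_def free_carrier_iff split: sum.split)
qed (auto simp: graph_model_simps free_algebra_simps coords_def lookup_add lookup_free
    graph_bracket_def wedge_def fun_eq_iff algebra_simps split: sum.split)

text \<open>A linear section of \<open>coords D\<close>: it represents a coordinate vector by
  generators and oriented edges.\<close>

definition normal_form :: "'v set \<Rightarrow> ('v \<times> 'v) set \<Rightarrow> ('v + 'v \<times> 'v \<Rightarrow> complex) \<Rightarrow> 'v magma \<Rightarrow>\<^sub>0 complex" where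
  "normal_form V D x = (\<Sum>v\<in>V. Poly_Mapping.single (Gen v) (x (Inl v))) +
    (\<Sum>(v, w)\<in>D. Poly_Mapping.single (Mul (Gen v) (Gen w)) (x (Inr (v, w))))"

lemma normal_form_add:
  "normal_form V D (\<lambda>i. x i + y i) = normal_form V D x + normal_form V D y"
  by (simp add: normal_form_def single_add sum.distrib case_prod_unfold algebra_simps)

lemma normal_form_delta:
  fixes V :: "'v set"
  assumes "finite V" "finite D"
  shows "v \<in> V \<Longrightarrow> normal_form V D (\<lambda>i. if i = Inl v then c else 0) = Poly_Mapping.single (Gen v) c"
    and "(v, w) \<in> D \<Longrightarrow>
      normal_form V D (\<lambda>i. if i = Inr (v, w) then c else 0) = Poly_Mapping.single (Mul (Gen v) (Gen w)) c"
    and "normal_form V D (\<lambda>_. 0) = 0"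
proof -
  have *: "Poly_Mapping.single k (if P then c else 0) = (if P then Poly_Mapping.single k c else 0)"
    for P and k :: "'v magma" by simp
  show "normal_form V D (\<lambda>i. if i = Inl v then c else 0) = Poly_Mapping.single (Gen v) c" if "v \<in> V"
    using assms that by (simp add: normal_form_def * sum.delta case_prod_unfold)
  show "normal_form V D (\<lambda>_. 0) = 0"
    by (simp add: normal_form_def case_prod_unfold)
  have **: "(\<Sum>(v', w')\<in>D. Poly_Mapping.single (Mul (Gen v') (Gen w'))
        (if (Inr (v', w') :: 'v + 'v \<times> 'v) = Inr (v, w) then c else 0)) =
      (\<Sum>p\<in>D. if p = (v, w) then Poly_Mapping.single (Mul (Gen v) (Gen w)) c else 0)"
    by (rule sum.cong) (auto simp: * split: if_splits)
  show "normal_form V D (\<lambda>i. if i = Inr (v, w) then c else 0) = Poly_Mapping.single (Mul (Gen v) (Gen w)) c"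
    if "(v, w) \<in> D"
    unfolding normal_form_def ** using assms that by (simp add: sum.delta)
qed

text \<open>Since no edge occurs in both orientations, the reversed word is absent from a normal
  form and antisymmetrising returns the coordinate unchanged.\<close>

lemma coords_normal_form:
  assumes "finite V" "finite D" "x \<in> carrier (graph_model V D)" "\<And>v w. (v, w) \<in> D \<Longrightarrow> (w, v) \<notin> D"
  shows "coords D (normal_form V D x) = x"
proof
  have gen: "Poly_Mapping.lookup (normal_form V D x) (Gen v) = (if v \<in> V then x (Inl v) else 0)" for v
    using assms(1) by (simp add: normal_form_def lookup_add lookup_sum lookup_single when_def case_prod_unfold)
  have mul: "Poly_Mapping.lookup (normal_form V D x) (Mul (Gen v) (Gen w)) =
      (if (v, w) \<in> D then x (Inr (v, w)) else 0)" for v w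
  proof -
    have "Poly_Mapping.lookup (normal_form V D x) (Mul (Gen v) (Gen w)) =
        (\<Sum>p\<in>D. if p = (v, w) then x (Inr (v, w)) else 0)"
      by (auto simp: normal_form_def lookup_add lookup_sum lookup_single when_def case_prod_unfold
        intro!: sum.cong)
    then show ?thesis using assms(2) by (simp add: sum.delta)
  qed
  fix i show "coords D (normal_form V D x) i = x i"
    using assms(3,4) by (auto simp: coords_def gen mul graph_model_simps split: sum.split)
qed

lemma normal_form_carrier:
  assumes "D \<subseteq> V \<times> V"
  shows "normal_form V D x \<in> carrier (free_algebra V)"
proof -
  have 1: "Poly_Mapping.keys (\<Sum>v\<in>V. Poly_Mapping.single (Gen v) (x (Inl v))) \<subseteq> Gen ` V"
    by (rule order_trans[OF keys_sum]) (auto simp: keys_single)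
  have 2: "Poly_Mapping.keys (\<Sum>(v, w)\<in>D. Poly_Mapping.single (Mul (Gen v) (Gen w)) (x (Inr (v, w))))
      \<subseteq> (\<lambda>(v, w). Mul (Gen v) (Gen w)) ` D"
    by (rule order_trans[OF keys_sum]) (auto simp: keys_single split: if_splits)
  have "Poly_Mapping.keys (normal_form V D x) \<subseteq> Gen ` V \<union> (\<lambda>(v, w). Mul (Gen v) (Gen w)) ` D"
    unfolding normal_form_def by (rule order_trans[OF Poly_Mapping.keys_add Un_mono[OF 1 2]])
  moreover have "set_magma w \<subseteq> V" if "w \<in> Gen ` V \<union> (\<lambda>(v, w). Mul (Gen v) (Gen w)) ` D" for w
    using that assms by auto
  ultimately show ?thesis by (auto simp: free_algebra_simps)
qed

lemma single_Mul:
  "Poly_Mapping.single (Mul u w) c =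
    c \<odot>\<^bsub>free_algebra V\<^esub> (Poly_Mapping.single u 1 \<otimes>\<^bsub>free_algebra V\<^esub> Poly_Mapping.single w 1)"
  by (rule free_algebra_eqI) (auto simp: lookup_free lookup_single when_def)

lemma single_carrier: "set_magma w \<subseteq> V \<Longrightarrow> Poly_Mapping.single w c \<in> carrier (free_algebra V)"
  by (auto simp: free_carrier_iff lookup_single when_def)

lemma sum_single_lookup:
  fixes f :: "'a \<Rightarrow>\<^sub>0 'b::comm_monoid_add"
  shows "(\<Sum>w\<in>Poly_Mapping.keys f. Poly_Mapping.single w (Poly_Mapping.lookup f w)) = f"
  by (rule poly_mapping_eqI) (simp add: lookup_sum lookup_single when_def in_keys_iff)

text \<open>
  A homomorphism from the free algebra into an algebra that satisfies the defining identities of a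
  graph Lie algebra sees only the terms of degree one and the edges.
\<close>
lemma hom_normal_form:
  fixes V :: "'v set" and B :: "(complex, 'b) module"
  assumes B: "complex_algebra B" and \<pi>: "\<pi> \<in> alg_hom (free_algebra V) B"
    and square: "\<And>x. x \<in> carrier B \<Longrightarrow> x \<otimes>\<^bsub>B\<^esub> x = \<zero>\<^bsub>B\<^esub>"
    and triple: "\<And>x y z. \<lbrakk>x \<in> carrier B; y \<in> carrier B; z \<in> carrier B\<rbrakk> \<Longrightarrow> x \<otimes>\<^bsub>B\<^esub> (y \<otimes>\<^bsub>B\<^esub> z) = \<zero>\<^bsub>B\<^esub>"
    and nonedge: "\<And>v w. \<lbrakk>v \<in> V; w \<in> V; v \<noteq> w; (v, w) \<notin> D; (w, v) \<notin> D\<rbrakk> \<Longrightarrow>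
      \<pi> (Poly_Mapping.single (Gen v) 1) \<otimes>\<^bsub>B\<^esub> \<pi> (Poly_Mapping.single (Gen w) 1) = \<zero>\<^bsub>B\<^esub>"
    and V: "finite V" and D: "D \<subseteq> V \<times> V" and asym: "\<And>v w. (v, w) \<in> D \<Longrightarrow> (w, v) \<notin> D"
    and f: "f \<in> carrier (free_algebra V)"
  shows "\<pi> (normal_form V D (coords D f)) = \<pi> f"
proof -
  interpret B: complex_algebra B by fact
  interpret F: complex_algebra "free_algebra V" by (rule complex_algebra_free)
  note \<pi>_simps = alg_hom_simps[OF \<pi>]
  have fin: "finite D" using V D finite_subset by blast
  let ?g = "\<lambda>w. Poly_Mapping.single w (1::complex)"
  have mono: "\<pi> (Poly_Mapping.single (Mul u w) c) = c \<odot>\<^bsub>B\<^esub> (\<pi> (?g u) \<otimes>\<^bsub>B\<^esub> \<pi> (?g w))"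
    if "set_magma u \<subseteq> V" "set_magma w \<subseteq> V" for u w c
    using that by (simp add: single_Mul[where V = V] \<pi>_simps single_carrier F.mult_closed)
  have gen: "\<pi> (?g w) \<in> carrier B" if "set_magma w \<subseteq> V" for w
    using that by (simp add: \<pi>_simps single_carrier)
  have zero: "\<pi> 0 = \<zero>\<^bsub>B\<^esub>"
    using alg_hom_zero[OF F.complex_algebra_axioms B \<pi>] by (simp add: free_algebra_simps)
  have mono': "\<pi> (?g (Mul u w)) = \<pi> (?g u) \<otimes>\<^bsub>B\<^esub> \<pi> (?g w)"
    if "set_magma u \<subseteq> V" "set_magma w \<subseteq> V" for u w
    using mono[OF that, of 1] gen that by (simp add: B.mult_closed)
  \<comment> \<open>Only products nested to the right are assumed to vanish; anticommutativity turns
    (x y) z into - z (x y).\<close>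
  have triple': "x \<otimes>\<^bsub>B\<^esub> y \<otimes>\<^bsub>B\<^esub> z = \<zero>\<^bsub>B\<^esub>"
    if "x \<in> carrier B" "y \<in> carrier B" "z \<in> carrier B" for x y z
    using that by (subst B.mult_anticomm[OF square, of z]) (simp_all add: B.mult_closed triple)
  have single: "\<pi> (normal_form V D (coords D (Poly_Mapping.single w c))) = \<pi> (Poly_Mapping.single w c)"
    if w: "set_magma w \<subseteq> V" for w c
  proof (cases w)
    case (Gen v)
    have "coords D (Poly_Mapping.single (Gen v) c) = (\<lambda>i. if i = Inl v then c else 0)"
      by (auto simp: coords_def lookup_single when_def fun_eq_iff split: sum.split)
    then show ?thesis using w Gen V fin by (simp add: normal_form_delta)
  next
    case (Mul u1 u2)
    show ?thesis
    proof (cases "\<exists>v w. u1 = Gen v \<and> u2 = Gen w")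
      case True
      then obtain v v' where uv: "u1 = Gen v" "u2 = Gen v'" by blast
      with Mul w have vV: "v \<in> V" "v' \<in> V" by auto
      consider "(v, v') \<in> D" | "(v', v) \<in> D" | "(v, v') \<notin> D" "(v', v) \<notin> D" by blast
      then show ?thesis
      proof cases
        case 1
        then have "coords D (Poly_Mapping.single w c) = (\<lambda>i. if i = Inr (v, v') then c else 0)"
          using asym[OF 1] by (simp add: Mul uv coords_single_Mul)
        then show ?thesis using 1 Mul uv V fin by (simp add: normal_form_delta)
      next
        case 2
        then have "coords D (Poly_Mapping.single w c) = (\<lambda>i. if i = Inr (v', v) then - c else 0)"
          using asym[OF 2] by (simp add: Mul uv coords_single_Mul)
        then have "\<pi> (normal_form V D (coords D (Poly_Mapping.single w c))) =
            (- c) \<odot>\<^bsub>B\<^esub> (\<pi> (?g (Gen v')) \<otimes>\<^bsub>B\<^esub> \<pi> (?g (Gen v)))"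
          using 2 V fin vV by (simp add: normal_form_delta mono)
        also have "\<dots> = c \<odot>\<^bsub>B\<^esub> (\<pi> (?g (Gen v)) \<otimes>\<^bsub>B\<^esub> \<pi> (?g (Gen v')))"
          using vV gen
          by (subst B.mult_anticomm[OF square, of "\<pi> (?g (Gen v))"])
            (simp_all add: B.mult_closed B.smult_assoc[symmetric])
        also have "\<dots> = \<pi> (Poly_Mapping.single w c)"
          using vV by (simp add: Mul uv mono)
        finally show ?thesis .
      next
        case 3
        have "coords D (Poly_Mapping.single w c) = (\<lambda>_. 0)"
          by (rule coords_single_nonedge) (use 3 in \<open>auto simp: Mul uv\<close>)
        moreover have "\<pi> (?g (Gen v)) \<otimes>\<^bsub>B\<^esub> \<pi> (?g (Gen v')) = \<zero>\<^bsub>B\<^esub>"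
          using 3 vV square nonedge gen by (cases "v = v'") auto
        ultimately show ?thesis
          using vV V fin by (simp add: normal_form_delta zero Mul uv mono)
      qed
    next
      case False
      then have "coords D (Poly_Mapping.single w c) = (\<lambda>_. 0)"
        by (intro coords_single_nonedge) (auto simp: Mul)
      \<comment> \<open>One of the factors is itself a product, so the word has length at least
        three: \<open>triple\<close> serves if it is the right factor, \<open>triple'\<close> if it
        is the left one.\<close>
      moreover have "\<pi> (?g u1) \<otimes>\<^bsub>B\<^esub> \<pi> (?g u2) = \<zero>\<^bsub>B\<^esub>"
        using False w Mul gen
        by (cases u1; cases u2) (auto simp: mono' triple triple' B.mult_closed)
      ultimately show ?thesis
        using w V fin by (simp add: normal_form_delta zero Mul mono)
    qed
  qed
  \<comment> \<open>Both sides are additive, so words suffice. Membership in the carrier joins the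
    induction because \<open>\<pi>\<close> is known to be additive only there.\<close>
  have "\<pi> (normal_form V D (coords D (\<Sum>w\<in>S. Poly_Mapping.single w (Poly_Mapping.lookup f w)))) =
      \<pi> (\<Sum>w\<in>S. Poly_Mapping.single w (Poly_Mapping.lookup f w)) \<and>
      (\<Sum>w\<in>S. Poly_Mapping.single w (Poly_Mapping.lookup f w)) \<in> carrier (free_algebra V)"
    if "finite S" "S \<subseteq> Poly_Mapping.keys f" for S
    using that
  proof (induction S)
    case empty
    have "coords D 0 = (\<lambda>_. 0)" by (auto simp: coords_def fun_eq_iff split: sum.split)
    then show ?case using V fin by (simp add: normal_form_delta free_algebra_simps)
  next
    case (insert w S)
    let ?s = "Poly_Mapping.single w (Poly_Mapping.lookup f w)"
    let ?r = "\<Sum>w\<in>S. Poly_Mapping.single w (Poly_Mapping.lookup f w)"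
    have w: "set_magma w \<subseteq> V" using insert.prems f by (auto simp: free_algebra_simps)
    have s: "?s \<in> carrier (free_algebra V)" using w by (rule single_carrier)
    have r: "\<pi> (normal_form V D (coords D ?r)) = \<pi> ?r" "?r \<in> carrier (free_algebra V)"
      using insert by auto
    have "coords D (?s + ?r) = (\<lambda>i. coords D ?s i + coords D ?r i)"
      using alg_hom_add[OF coords_hom[OF D] s r(2)] by (simp add: free_algebra_simps graph_model_simps)
    then have "\<pi> (normal_form V D (coords D (?s + ?r))) =
        \<pi> (normal_form V D (coords D ?s)) \<oplus>\<^bsub>B\<^esub> \<pi> (normal_form V D (coords D ?r))"
      using alg_hom_add[OF \<pi> normal_form_carrier[OF D] normal_form_carrier[OF D]]
      by (simp add: normal_form_add free_algebra_simps)
    also have "\<dots> = \<pi> (?s + ?r)"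
      using single[OF w] r alg_hom_add[OF \<pi> s r(2)] by (simp add: free_algebra_simps)
    finally show ?case
      using insert.hyps F.add.m_closed[OF s r(2)] by (simp add: free_algebra_simps)
  qed
  from this[of "Poly_Mapping.keys f"] show ?thesis
    by (simp add: sum_single_lookup)
qed

section \<open>Identification of the iterated quotient with the coordinate model\<close>

context algebra_with_ideal
begin

lemma quotient_square:
  assumes "\<And>x. x \<in> carrier A \<Longrightarrow> x \<otimes>\<^bsub>A\<^esub> x \<in> I" "X \<in> carrier Q"
  shows "X \<otimes>\<^bsub>Q\<^esub> X = \<zero>\<^bsub>Q\<^esub>"
proof -
  from assms(2) obtain x where "x \<in> carrier A" "X = I +>\<^bsub>A\<^esub> x" by (auto simp: carrier_Q)
  then show ?thesis by (simp add: mult_Q coset_eq_zero_iff mult_closed assms(1))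
qed

lemma quotient_triple:
  assumes "\<And>x y z. \<lbrakk>x \<in> carrier A; y \<in> carrier A; z \<in> carrier A\<rbrakk> \<Longrightarrow> x \<otimes>\<^bsub>A\<^esub> (y \<otimes>\<^bsub>A\<^esub> z) \<in> I"
    and "X \<in> carrier Q" "Y \<in> carrier Q" "Z \<in> carrier Q"
  shows "X \<otimes>\<^bsub>Q\<^esub> (Y \<otimes>\<^bsub>Q\<^esub> Z) = \<zero>\<^bsub>Q\<^esub>"
proof -
  from assms(2-4) obtain x y z where "x \<in> carrier A" "y \<in> carrier A" "z \<in> carrier A"
      "X = I +>\<^bsub>A\<^esub> x" "Y = I +>\<^bsub>A\<^esub> y" "Z = I +>\<^bsub>A\<^esub> z"
    by (auto simp: carrier_Q)
  then show ?thesis by (simp add: mult_Q coset_eq_zero_iff mult_closed assms(1))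
qed

end

lemma model_jacobiator: "jacobiator (graph_model V D) x y z = \<zero>\<^bsub>graph_model V D\<^esub>"
  by (simp add: jacobiator_def graph_model_simps model_triple_zero)

text \<open>None of the three ideals is computed. The map \<open>coords D\<close> kills each of them
  in turn and descends to \<open>g3\<close>. By \<open>hom_normal_form\<close> every element is the
  class of the normal form of its coordinates, which makes \<open>g3\<close> injective;
  \<open>coords_normal_form\<close> makes it surjective.\<close>

lemma graph_lie_algebra_iso:
  fixes V :: "'v set"
  assumes V: "finite V" and D: "D \<subseteq> V \<times> V" and asym: "\<And>v w. (v, w) \<in> D \<Longrightarrow> (w, v) \<notin> D"
  shows "algebra_isomorphic (graph_lie_algebra V {{v, w} | v w. (v, w) \<in> D}) (graph_model V D)"
proof -
  let ?E = "{{v, w} | v w. (v, w) \<in> D}"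
  let ?M = "graph_model V D"
  interpret M: complex_algebra ?M by (rule complex_algebra_model)
  have subspace_ker: "VectorSpace.subspace complex_field (alg_kernel A ?M g) A"
    if "complex_algebra A" "g \<in> alg_hom A ?M" for A :: "(complex, 'b) module" and g
    using alg_kernel_ideal[OF that(1) M.complex_algebra_axioms that(2)] by (simp add: algebra_ideal_def)

  interpret F: complex_algebra "free_algebra V" by (rule complex_algebra_free)
  have rel: "lie_relations (free_algebra V) \<subseteq> carrier (free_algebra V)"
    by (auto simp: lie_relations_def jacobiator_def intro!: F.mult_closed F.add.m_closed)
  interpret q1: algebra_with_ideal "free_algebra V" "lie_ideal V"
    unfolding lie_ideal_def by unfold_locales (rule F.generated_ideal_ideal[OF rel])
  have Q1: "q1.Q = free_lie V" by (simp add: free_lie_def)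
  note coords = coords_hom[OF D]
  have "lie_ideal V \<subseteq> alg_kernel (free_algebra V) ?M (coords D)"
    unfolding lie_ideal_def
  proof (rule F.generated_ideal_least)
    show "algebra_ideal (alg_kernel (free_algebra V) ?M (coords D)) (free_algebra V)"
      by (rule alg_kernel_ideal[OF F.complex_algebra_axioms M.complex_algebra_axioms coords])
    \<comment> \<open>Jacobi expressions go to zero because all triple products of the model vanish,
      squares because minors alternate.\<close>
    have "coords D (jacobiator (free_algebra V) x y z) = jacobiator ?M (coords D x) (coords D y) (coords D z)"
      if "x \<in> carrier (free_algebra V)" "y \<in> carrier (free_algebra V)" "z \<in> carrier (free_algebra V)" for x y z
      using that by (simp add: jacobiator_def alg_hom_simps[OF coords] F.mult_closed)
    moreover have "coords D (x \<otimes>\<^bsub>free_algebra V\<^esub> x) = \<zero>\<^bsub>?M\<^esub>" if "x \<in> carrier (free_algebra V)" for x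
      using that by (simp add: alg_hom_mult[OF coords] graph_model_simps graph_bracket_linear fun_eq_iff)
    ultimately have "coords D r = \<zero>\<^bsub>?M\<^esub>" if "r \<in> lie_relations (free_algebra V)" for r
      using that by (auto simp only: lie_relations_def model_jacobiator Un_iff mem_Collect_eq)
    then show "lie_relations (free_algebra V) \<subseteq> alg_kernel (free_algebra V) ?M (coords D)"
      using rel by (auto simp only: alg_kernel_def)
  qed
  then obtain g1 where g1: "g1 \<in> alg_hom (free_lie V) ?M"
      "\<And>x. x \<in> carrier (free_algebra V) \<Longrightarrow> g1 (lie_ideal V +>\<^bsub>free_algebra V\<^esub> x) = coords D x"
    using q1.quotient_lift[OF M.complex_algebra_axioms coords] unfolding Q1 by blast

  interpret L1: complex_algebra "free_lie V" using q1.complex_algebra_Q by (simp add: Q1)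
  have square1: "X \<otimes>\<^bsub>free_lie V\<^esub> X = \<zero>\<^bsub>free_lie V\<^esub>" if "X \<in> carrier (free_lie V)" for X
  proof (rule q1.quotient_square[unfolded Q1, OF _ that])
    fix x assume "x \<in> carrier (free_algebra V)"
    then show "x \<otimes>\<^bsub>free_algebra V\<^esub> x \<in> lie_ideal V"
      unfolding lie_ideal_def by (intro generated_ideal_incl[THEN subsetD]) (auto simp: lie_relations_def)
  qed
  let ?J2 = "lower_central_series (free_lie V) 3"
  interpret q2: algebra_with_ideal "free_lie V" ?J2
    by unfold_locales (rule L1.lcs_3_ideal[OF square1])
  have Q2: "q2.Q = free_2_step V" by (simp add: free_2_step_def)
  have "?J2 \<subseteq> alg_kernel (free_lie V) ?M g1"
    by (rule L1.lcs_3_least[OF subspace_ker[OF L1.complex_algebra_axioms g1(1)]])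
      (simp add: alg_kernel_def alg_hom_simps[OF g1(1)] L1.mult_closed graph_model_simps model_triple_zero)
  then obtain g2 where g2: "g2 \<in> alg_hom (free_2_step V) ?M"
      "\<And>x. x \<in> carrier (free_lie V) \<Longrightarrow> g2 (?J2 +>\<^bsub>free_lie V\<^esub> x) = g1 x"
    using q2.quotient_lift[OF M.complex_algebra_axioms g1(1)] unfolding Q2 by blast

  interpret L2: complex_algebra "free_2_step V" using q2.complex_algebra_Q by (simp add: Q2)
  have square2: "X \<otimes>\<^bsub>free_2_step V\<^esub> X = \<zero>\<^bsub>free_2_step V\<^esub>" if "X \<in> carrier (free_2_step V)" for X
    using q2.quotient_square[unfolded Q2, OF _ that] square1 q2.I_zero by simp
  have triple2: "X \<otimes>\<^bsub>free_2_step V\<^esub> (Y \<otimes>\<^bsub>free_2_step V\<^esub> Z) = \<zero>\<^bsub>free_2_step V\<^esub>"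
    if "X \<in> carrier (free_2_step V)" "Y \<in> carrier (free_2_step V)" "Z \<in> carrier (free_2_step V)" for X Y Z
    using that by (intro q2.quotient_triple[unfolded Q2] L1.mult_in_lcs_3 L1.mult_in_derived)
  let ?gen = "\<lambda>v. Poly_Mapping.single (Gen v) (1::complex)"
  have gen: "?gen v \<in> carrier (free_algebra V)" if "v \<in> V" for v
    using that by (simp add: single_carrier)
  have gen1: "free_lie_gen V v \<in> carrier (free_lie V)" "g1 (free_lie_gen V v) = coords D (?gen v)"
    if "v \<in> V" for v
    using gen[OF that] g1(2) alg_hom_closed[OF q1.coset_hom] by (simp_all add: free_lie_gen_def Q1)
  have gen2: "free_2_step_gen V v \<in> carrier (free_2_step V)" "g2 (free_2_step_gen V v) = coords D (?gen v)"
    if "v \<in> V" for v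
    using gen1[OF that] g2(2) alg_hom_closed[OF q2.coset_hom] by (simp_all add: free_2_step_gen_def Q2)
  let ?S = "{free_2_step_gen V v \<otimes>\<^bsub>free_2_step V\<^esub> free_2_step_gen V w | v w.
      v \<in> V \<and> w \<in> V \<and> v \<noteq> w \<and> {v, w} \<notin> ?E}"
  have J3: "nonedge_ideal V ?E = generated_ideal (free_2_step V) ?S"
    by (simp add: nonedge_ideal_def)
  have S: "?S \<subseteq> carrier (free_2_step V)" using gen2 by (auto intro!: L2.mult_closed)
  interpret q3: algebra_with_ideal "free_2_step V" "nonedge_ideal V ?E"
    unfolding J3 by unfold_locales (rule L2.generated_ideal_ideal[OF S])
  let ?L = "graph_lie_algebra V ?E"
  have Q3: "q3.Q = ?L" by (simp add: graph_lie_algebra_def)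
  have "nonedge_ideal V ?E \<subseteq> alg_kernel (free_2_step V) ?M g2"
    unfolding J3
  proof (rule L2.generated_ideal_least)
    show "algebra_ideal (alg_kernel (free_2_step V) ?M g2) (free_2_step V)"
      by (rule alg_kernel_ideal[OF L2.complex_algebra_axioms M.complex_algebra_axioms g2(1)])
    have "graph_bracket D (coords D (?gen v)) (coords D (?gen w)) = (\<lambda>_. 0)"
      if "{v, w} \<notin> ?E" for v w
      using that by (auto simp: fun_eq_iff graph_bracket_def wedge_def coords_def lookup_single when_def
        split: sum.split)
    then show "?S \<subseteq> alg_kernel (free_2_step V) ?M g2"
      using S gen2 by (auto simp: alg_kernel_def alg_hom_mult[OF g2(1)] graph_model_simps
        simp del: graph_bracket_simps intro!: L2.mult_closed)
  qed
  then obtain g3 where g3: "g3 \<in> alg_hom ?L ?M"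
      "\<And>x. x \<in> carrier (free_2_step V) \<Longrightarrow> g3 (nonedge_ideal V ?E +>\<^bsub>free_2_step V\<^esub> x) = g2 x"
    using q3.quotient_lift[OF M.complex_algebra_axioms g2(1)] unfolding Q3 by blast

  interpret L3: complex_algebra ?L using q3.complex_algebra_Q by (simp add: Q3)
  \<comment> \<open>The composite of the three coset maps. It is onto, so \<open>g3\<close> can be
    inverted on images of elements of the free algebra.\<close>
  define \<pi> where "\<pi> f = nonedge_ideal V ?E +>\<^bsub>free_2_step V\<^esub>
      (?J2 +>\<^bsub>free_lie V\<^esub> (lie_ideal V +>\<^bsub>free_algebra V\<^esub> f))" for f
  have \<pi>: "\<pi> \<in> alg_hom (free_algebra V) ?L"
    using alg_hom_comp[OF alg_hom_comp[OF q1.coset_hom[unfolded Q1] q2.coset_hom[unfolded Q2]]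
        q3.coset_hom[unfolded Q3]] by (simp add: \<pi>_def[abs_def] comp_def)
  have surj: "\<exists>f\<in>carrier (free_algebra V). X = \<pi> f" if "X \<in> carrier ?L" for X
    using that q1.carrier_Q q2.carrier_Q q3.carrier_Q unfolding Q1 Q2 Q3 \<pi>_def by auto
  have g3_\<pi>: "g3 (\<pi> f) = coords D f" if "f \<in> carrier (free_algebra V)" for f
    using that g1(2) g2(2) g3(2) alg_hom_closed[OF q1.coset_hom] alg_hom_closed[OF q2.coset_hom]
    by (simp add: \<pi>_def Q1 Q2)
  have square3: "X \<otimes>\<^bsub>?L\<^esub> X = \<zero>\<^bsub>?L\<^esub>" if "X \<in> carrier ?L" for X
    using q3.quotient_square[unfolded Q3, OF _ that] square2 q3.I_zero by simp
  have triple3: "X \<otimes>\<^bsub>?L\<^esub> (Y \<otimes>\<^bsub>?L\<^esub> Z) = \<zero>\<^bsub>?L\<^esub>"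
    if "X \<in> carrier ?L" "Y \<in> carrier ?L" "Z \<in> carrier ?L" for X Y Z
    using q3.quotient_triple[unfolded Q3, OF _ that] triple2 q3.I_zero by simp
  have nonedge3: "\<pi> (?gen v) \<otimes>\<^bsub>?L\<^esub> \<pi> (?gen w) = \<zero>\<^bsub>?L\<^esub>"
    if vw: "v \<in> V" "w \<in> V" "v \<noteq> w" "(v, w) \<notin> D" "(w, v) \<notin> D" for v w
  proof -
    have "{v, w} \<notin> ?E" using vw by (auto simp: doubleton_eq_iff)
    then have "free_2_step_gen V v \<otimes>\<^bsub>free_2_step V\<^esub> free_2_step_gen V w \<in> nonedge_ideal V ?E"
      using vw unfolding J3 by (intro generated_ideal_incl[THEN subsetD]) blast
    then have "nonedge_ideal V ?E +>\<^bsub>free_2_step V\<^esub>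
        (free_2_step_gen V v \<otimes>\<^bsub>free_2_step V\<^esub> free_2_step_gen V w) = \<zero>\<^bsub>?L\<^esub>"
      using q3.coset_eq_zero_iff gen2 vw by (simp add: Q3 L2.mult_closed)
    then show ?thesis
      using q3.mult_Q gen2 vw by (simp add: \<pi>_def Q3 free_2_step_gen_def free_lie_gen_def)
  qed
  have nf: "\<pi> (normal_form V D (coords D f)) = \<pi> f" if "f \<in> carrier (free_algebra V)" for f
    by (rule hom_normal_form[OF L3.complex_algebra_axioms \<pi>]) (use that V D asym square3 triple3 nonedge3 in auto)
  have "bij_betw g3 (carrier ?L) (carrier ?M)"
  proof (rule bij_betw_byWitness[where f' = "\<lambda>x. \<pi> (normal_form V D x)"])
    show "\<forall>X\<in>carrier ?L. \<pi> (normal_form V D (g3 X)) = X"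
      using surj nf g3_\<pi> by force
    show "\<forall>x\<in>carrier ?M. g3 (\<pi> (normal_form V D x)) = x"
      using V D asym finite_subset[OF D] by (simp add: g3_\<pi> normal_form_carrier coords_normal_form)
    show "g3 ` carrier ?L \<subseteq> carrier ?M" using alg_hom_closed[OF g3(1)] by blast
    show "(\<lambda>x. \<pi> (normal_form V D x)) ` carrier ?M \<subseteq> carrier ?L"
      using alg_hom_closed[OF \<pi>] normal_form_carrier[OF D] by blast
  qed
  then show ?thesis using g3(1) by (auto simp: algebra_isomorphic_iff)
qed

section \<open>Ranks of adjoint maps in the deformed algebra\<close>

text \<open>Gaussian elimination, one equation and one unknown at a time. It serves both to bound
  ranks from above and to find the kernel vector in the final dimension count.\<close>

lemma underdetermined_system:
  fixes A :: "'r \<Rightarrow> 'c \<Rightarrow> 'f::field"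
  assumes "finite R" "finite C" "card R < card C"
  shows "\<exists>c. (\<exists>j\<in>C. c j \<noteq> 0) \<and> (\<forall>i\<in>R. (\<Sum>j\<in>C. A i j * c j) = 0)"
  using assms
proof (induction R arbitrary: A C)
  case empty
  then have "C \<noteq> {}" by auto
  then show ?case by (intro exI[of _ "\<lambda>_. 1"]) auto
next
  case (insert i R)
  show ?case
  proof (cases "\<forall>j\<in>C. A i j = 0")
    case True
    from insert.IH[of C A] insert.prems insert.hyps obtain c
      where "\<exists>j\<in>C. c j \<noteq> 0" "\<forall>i\<in>R. (\<Sum>j\<in>C. A i j * c j) = 0" by auto
    then show ?thesis using True by (intro exI[of _ c]) auto
  next
    case False
    then obtain p where p: "p \<in> C" "A i p \<noteq> 0" by blast
    let ?C = "C - {p}"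
    \<comment> \<open>The pivot p is eliminated from row k by subtracting a multiple of row i; row i
      then determines the value of the solution at p.\<close>
    let ?B = "\<lambda>k j. A k j - A k p * A i j / A i p"
    have "card R < card ?C" using insert.prems insert.hyps p by simp
    with insert.IH[of ?C ?B] insert.prems obtain c
      where c: "\<exists>j\<in>?C. c j \<noteq> 0" "\<forall>k\<in>R. (\<Sum>j\<in>?C. ?B k j * c j) = 0" by auto
    define s where "s = (\<Sum>j\<in>?C. A i j * c j)"
    define c' where "c' = c(p := - s / A i p)"
    have split: "(\<Sum>j\<in>C. A k j * c' j) = A k p * (- s / A i p) + (\<Sum>j\<in>?C. A k j * c j)" for k
    proof -
      have "(\<Sum>j\<in>C. A k j * c' j) = A k p * c' p + (\<Sum>j\<in>?C. A k j * c' j)"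
        using p insert.prems by (intro sum.remove) auto
      also have "(\<Sum>j\<in>?C. A k j * c' j) = (\<Sum>j\<in>?C. A k j * c j)"
        by (intro sum.cong) (auto simp: c'_def)
      finally show ?thesis by (simp add: c'_def)
    qed
    have "(\<Sum>j\<in>C. A k j * c' j) = 0" if "k \<in> R" for k
    proof -
      have "(\<Sum>j\<in>?C. ?B k j * c j) = (\<Sum>j\<in>?C. A k j * c j) - (A k p / A i p) * s"
        unfolding s_def sum_distrib_left sum_subtractf[symmetric]
        by (intro sum.cong) (auto simp: algebra_simps)
      then show ?thesis using c(2) that by (simp add: split)
    qed
    moreover have "(\<Sum>j\<in>C. A i j * c' j) = 0" using p by (simp add: split s_def)
    moreover have "\<exists>j\<in>C. c' j \<noteq> 0" using c(1) by (auto simp: c'_def)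
    ultimately show ?thesis by (intro exI[of _ c']) auto
  qed
qed

lemma sum_single_term:
  fixes c f :: "'j \<Rightarrow> complex"
  assumes "finite J" "j \<in> J" "\<And>l. \<lbrakk>l \<in> J; l \<noteq> j\<rbrakk> \<Longrightarrow> c l * f l = 0"
  shows "(\<Sum>l\<in>J. c l * f l) = c j * f j"
proof -
  have "(\<Sum>l\<in>J. c l * f l) = c j * f j + (\<Sum>l\<in>J - {j}. c l * f l)"
    using assms(1,2) by (rule sum.remove)
  then show ?thesis using assms(3) by (simp add: sum.neutral)
qed

definition basis_vec :: "'i \<Rightarrow> 'i \<Rightarrow> complex" where
  "basis_vec i = (\<lambda>j. if j = i then 1 else 0)"

lemma deformed_hom_sum:
  assumes k: "k \<in> alg_hom (deformed_model V D a b z) (deformed_model V' D' a' b' z')"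
    and "finite J" "y \<in> J \<rightarrow> carrier (deformed_model V D a b z)"
  shows "k (\<lambda>i. \<Sum>j\<in>J. c j * y j i) = (\<lambda>i. \<Sum>j\<in>J. c j * k (y j) i)"
  using assms(2,3)
proof (induction J)
  case empty
  show ?case
    using alg_hom_smult[OF k, of "\<lambda>_. 0" 0] by (simp add: deformed_model_simps)
next
  case (insert j J)
  have y: "y j \<in> carrier (deformed_model V D a b z)" using insert.prems by auto
  have cy: "(\<lambda>i. c j * y j i) \<in> carrier (deformed_model V D a b z)"
    using y by (simp add: deformed_model_simps)
  have s: "(\<lambda>i. \<Sum>j\<in>J. c j * y j i) \<in> carrier (deformed_model V D a b z)"
    using insert.prems by (auto simp: deformed_model_simps Pi_iff intro!: sum.neutral)
  have "k (\<lambda>i. \<Sum>j\<in>insert j J. c j * y j i) = k (\<lambda>i. c j * y j i + (\<Sum>j\<in>J. c j * y j i))"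
    using insert.hyps by simp
  also have "\<dots> = (\<lambda>i. k (\<lambda>i. c j * y j i) i + k (\<lambda>i. \<Sum>j\<in>J. c j * y j i) i)"
    using alg_hom_add[OF k cy s] by (simp add: deformed_model_simps)
  also have "\<dots> = (\<lambda>i. c j * k (y j) i + (\<Sum>j\<in>J. c j * k (y j) i))"
    using alg_hom_smult[OF k y, of "c j"] insert by (simp add: deformed_model_simps)
  finally show ?case using insert.hyps by simp
qed

text \<open>
  Only families indexed by sets of vertices are tested. They are long enough to detect the ranks
  that are needed, which are at most \<open>deg a + 1\<close> and the degrees of vertices.
\<close>
definition ad_rank_le ::
    "(complex, 'v + 'i \<Rightarrow> complex) module \<Rightarrow> nat \<Rightarrow> ('v + 'i \<Rightarrow> complex) \<Rightarrow> bool" where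
  "ad_rank_le M r p \<longleftrightarrow> (\<forall>(J::'v set) y. finite J \<longrightarrow> r < card J \<longrightarrow> y \<in> J \<rightarrow> carrier M \<longrightarrow>
    (\<exists>c. (\<exists>j\<in>J. c j \<noteq> 0) \<and> (\<forall>i. (\<Sum>j\<in>J. c j * (p \<otimes>\<^bsub>M\<^esub> y j) i) = 0)))"

text \<open>All brackets with p are supported in R, so a relation among more than r of them is a
  system of at most r equations.\<close>

lemma ad_rank_leI:
  assumes "finite R" "card R \<le> r"
    and "\<And>y i. \<lbrakk>y \<in> carrier M; i \<notin> R\<rbrakk> \<Longrightarrow> (p \<otimes>\<^bsub>M\<^esub> y) i = 0"
  shows "ad_rank_le M r p"
  unfolding ad_rank_le_def
proof (intro allI impI)
  fix J :: "'a set" and y assume J: "finite J" "r < card J" "y \<in> J \<rightarrow> carrier M"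
  obtain c where c: "\<exists>j\<in>J. c j \<noteq> 0" "\<forall>i\<in>R. (\<Sum>j\<in>J. (p \<otimes>\<^bsub>M\<^esub> y j) i * c j) = 0"
    using underdetermined_system[of R J "\<lambda>i j. (p \<otimes>\<^bsub>M\<^esub> y j) i"] assms J by auto
  have "(\<Sum>j\<in>J. c j * (p \<otimes>\<^bsub>M\<^esub> y j) i) = 0" for i
    using c(2) assms(3) J(3) by (cases "i \<in> R") (auto simp: mult.commute Pi_iff intro!: sum.neutral)
  then show "\<exists>c. (\<exists>j\<in>J. c j \<noteq> 0) \<and> (\<forall>i. (\<Sum>j\<in>J. c j * (p \<otimes>\<^bsub>M\<^esub> y j) i) = 0)"
    using c(1) by blast
qed

text \<open>The test family is pulled back along the bijection k, and k carries a linear relation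
  among brackets with p to one among brackets with k p.\<close>

lemma ad_rank_le_iso:
  assumes k: "k \<in> alg_hom (deformed_model V D a b z) (deformed_model V D a b z')"
    and bij: "bij_betw k (carrier (deformed_model V D a b z)) (carrier (deformed_model V D a b z'))"
    and z: "z \<in> carrier (graph_model V D)"
    and p: "p \<in> carrier (deformed_model V D a b z)"
    and rank: "ad_rank_le (deformed_model V D a b z) r p"
  shows "ad_rank_le (deformed_model V D a b z') r (k p)"
  unfolding ad_rank_le_def
proof (intro allI impI)
  let ?M = "deformed_model V D a b z" and ?N = "deformed_model V D a b z'"
  interpret M: complex_algebra ?M by (rule complex_algebra_deformed[OF z])
  fix J :: "'a set" and y assume J: "finite J" "r < card J" "y \<in> J \<rightarrow> carrier ?N"
  define x where "x = inv_into (carrier ?M) k \<circ> y"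
  have x: "x j \<in> carrier ?M" "k (x j) = y j" if "j \<in> J" for j
  proof -
    have "y j \<in> k ` carrier ?M" using bij J(3) that by (auto simp: bij_betw_def)
    then show "x j \<in> carrier ?M" "k (x j) = y j" by (simp_all add: x_def inv_into_into f_inv_into_f)
  qed
  obtain c where c: "\<exists>j\<in>J. c j \<noteq> 0" "\<forall>i. (\<Sum>j\<in>J. c j * (p \<otimes>\<^bsub>?M\<^esub> x j) i) = 0"
    using rank[unfolded ad_rank_le_def, rule_format, OF J(1,2), of x] x(1) by auto
  have "(\<lambda>i. \<Sum>j\<in>J. c j * k (p \<otimes>\<^bsub>?M\<^esub> x j) i) = k (\<lambda>i. \<Sum>j\<in>J. c j * (p \<otimes>\<^bsub>?M\<^esub> x j) i)"
    using x p by (intro deformed_hom_sum[OF k J(1), symmetric]) (auto intro: M.mult_closed)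
  also have "\<dots> = k (\<lambda>i. 0)" using c(2) by simp
  also have "\<dots> = (\<lambda>i. 0)"
    using alg_hom_smult[OF k, of "\<lambda>_. 0" 0] by (simp add: deformed_model_simps)
  finally have "(\<Sum>j\<in>J. c j * k (p \<otimes>\<^bsub>?M\<^esub> x j) i) = 0" for i by (rule fun_cong)
  moreover have "(\<Sum>j\<in>J. c j * k (p \<otimes>\<^bsub>?M\<^esub> x j) i) = (\<Sum>j\<in>J. c j * (k p \<otimes>\<^bsub>?N\<^esub> y j) i)" for i
    using x p by (intro sum.cong) (simp_all add: alg_hom_mult[OF k])
  ultimately show "\<exists>c. (\<exists>j\<in>J. c j \<noteq> 0) \<and> (\<forall>i. (\<Sum>j\<in>J. c j * (k p \<otimes>\<^bsub>?N\<^esub> y j) i) = 0)"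
    using c(1) by auto
qed

section \<open>Rank bounds for the deformation at a non-edge\<close>

definition nbrs :: "('v \<times> 'v) set \<Rightarrow> 'v \<Rightarrow> 'v set" where
  "nbrs D v = {w. (v, w) \<in> D \<or> (w, v) \<in> D}"

text \<open>The coordinate \<open>\<tau>\<close> receives the new value of [a, b]. A vertex target
  must be isolated so that triple products stay zero; an edge target must be disjoint from the
  non-edge for the lower rank bounds.\<close>

locale deformation =
  fixes V :: "'v set" and D :: "('v \<times> 'v) set" and a b :: 'v and \<tau> :: "'v + 'v \<times> 'v"
  assumes finite_V: "finite V" and D_sub: "D \<subseteq> V \<times> V"
    and asym: "(v, w) \<in> D \<Longrightarrow> (w, v) \<notin> D"
    and ab: "a \<in> V" "b \<in> V" "a \<noteq> b" "(a, b) \<notin> D" "(b, a) \<notin> D"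
    and \<tau>_mem: "\<tau> \<in> V <+> D"
    and \<tau>_vertex: "\<tau> = Inl v \<Longrightarrow> v \<notin> {a, b} \<and> v \<notin> Field D"
    and \<tau>_edge: "\<tau> = Inr (v, w) \<Longrightarrow> {v, w} \<inter> {a, b} = {}"
begin

abbreviation M :: "complex \<Rightarrow> (complex, 'v + 'v \<times> 'v \<Rightarrow> complex) module" where
  "M t \<equiv> deformed_model V D a b (\<lambda>i. if i = \<tau> then t else 0)"

lemma M_0: "M 0 = graph_model V D"
  using deformed_model_0[of V D a b] by (simp add: if_distrib cong: if_cong)

lemma finite_D: "finite D"
  using finite_V D_sub finite_subset by blast

lemma finite_nbrs: "finite (nbrs D v)"
  using finite_V D_sub by (auto simp: nbrs_def intro: finite_subset[of _ V])

lemma irrefl: "(v, v) \<notin> D"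
  using asym by blast

lemma z_carrier: "(\<lambda>i. if i = \<tau> then t else 0) \<in> carrier (graph_model V D)"
  using \<tau>_mem by (auto simp: graph_model_simps)

lemma complex_algebra_M: "complex_algebra (M t)"
  by (rule complex_algebra_deformed[OF z_carrier])

lemma M_triple_zero: "x \<otimes>\<^bsub>M t\<^esub> (y \<otimes>\<^bsub>M t\<^esub> w) = \<zero>\<^bsub>M t\<^esub>"
  by (rule deformed_triple_zero) (use \<tau>_vertex in \<open>auto split: if_splits\<close>)

lemma basis_carrier: "i \<in> V <+> D \<Longrightarrow> basis_vec i \<in> carrier (M t)"
  by (auto simp: deformed_model_simps basis_vec_def)

text \<open>A bracket with v is a combination of the edges at v, and there are deg v of these; the
  \<open>if\<close> picks the orientation that occurs in D.\<close>

lemma rank_vertex_M0: "ad_rank_le (M 0) (card (nbrs D v)) (basis_vec (Inl v))"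
proof (rule ad_rank_leI)
  let ?R = "(\<lambda>w. Inr (if (v, w) \<in> D then (v, w) else (w, v))) ` nbrs D v :: ('v + 'v \<times> 'v) set"
  show "finite ?R" "card ?R \<le> card (nbrs D v)"
    using finite_nbrs card_image_le by auto
  fix y :: "'v + 'v \<times> 'v \<Rightarrow> complex" and i assume i: "i \<notin> ?R"
  have "wedge (basis_vec (Inl v)) y x x' = 0" if "i = Inr (x, x')" "(x, x') \<in> D" for x x'
  proof -
    have "x \<noteq> v"
      using i that by (force simp: nbrs_def)
    moreover have "x' \<noteq> v"
      using i that asym[of x x'] by (force simp: nbrs_def)
    ultimately show ?thesis by (simp add: wedge_def basis_vec_def)
  qed
  then show "(basis_vec (Inl v) \<otimes>\<^bsub>M 0\<^esub> y) i = 0"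
    by (cases i) (auto simp: deformed_model_simps)
qed

text \<open>Edge vectors are central, so the set of possibly nonzero coordinates is empty.\<close>

lemma rank_edge_M0: "ad_rank_le (M 0) r (basis_vec (Inr e))"
  by (rule ad_rank_leI[where R = "{}"])
    (simp_all add: deformed_model_simps basis_vec_def wedge_def graph_bracket_def split: sum.split)

lemma M_mult_basis:
  assumes "(v, w) \<in> D"
  shows "(p \<otimes>\<^bsub>M t\<^esub> basis_vec (Inl j)) (Inr (v, w)) =
    (if j = w then p (Inl v) else 0) - (if j = v then p (Inl w) else 0) +
    (if Inr (v, w) = \<tau> then t * ((if j = b then p (Inl a) else 0) - (if j = a then p (Inl b) else 0)) else 0)"
  using assms by (auto simp: deformed_model_simps wedge_def basis_vec_def)

text \<open>The coordinate of the edge ij sees only j among the test vectors and so isolates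
  \<open>c j\<close>. The exception is the coordinate \<open>\<tau>\<close>, to which a and b
  contribute as well; it is treated after all other coefficients are known to vanish. The assumption
  \<open>other\<close> fits both uses: a test family of neighbours of i only, and one for i = a
  enlarged by b.\<close>

lemma neighbour_coefficients_zero:
  assumes p: "p (Inl i) \<noteq> 0" and J: "finite J" "i \<notin> J"
    and sum: "\<And>k. (\<Sum>j\<in>J. c j * (p \<otimes>\<^bsub>M t\<^esub> basis_vec (Inl j)) k) = 0"
    and other: "\<And>j. \<lbrakk>j \<in> J; j \<notin> nbrs D i\<rbrakk> \<Longrightarrow> i = a"
    and j: "j \<in> J" "j \<in> nbrs D i"
  shows "c j = 0"
proof -
  obtain v w where e: "(v, w) \<in> D" "(v, w) = (i, j) \<or> (v, w) = (j, i)"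
    using j(2) by (auto simp: nbrs_def)
  have ne: "i \<noteq> j" using J(2) j(1) by auto
  define sgn :: complex where "sgn = (if (v, w) = (i, j) then 1 else - 1)"
  have off_\<tau>: "c l = 0"
    if "l \<in> J" "(v', w') \<in> D" "(v', w') = (i, l) \<or> (v', w') = (l, i)" "Inr (v', w') \<noteq> \<tau>" for l v' w'
  proof -
    have "(\<Sum>j\<in>J. c j * (p \<otimes>\<^bsub>M t\<^esub> basis_vec (Inl j)) (Inr (v', w'))) =
        c l * (p \<otimes>\<^bsub>M t\<^esub> basis_vec (Inl l)) (Inr (v', w'))"
      using that J by (intro sum_single_term) (auto simp: M_mult_basis)
    moreover have "i \<noteq> l" using J(2) that(1) by auto
    then have "(p \<otimes>\<^bsub>M t\<^esub> basis_vec (Inl l)) (Inr (v', w')) \<noteq> 0"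
      using that p by (auto simp: M_mult_basis)
    ultimately show ?thesis using sum by simp
  qed
  show ?thesis
  proof (cases "Inr (v, w) = \<tau>")
    case False
    then show ?thesis using off_\<tau> j(1) e by blast
  next
    case True
    then have disj: "{v, w} \<inter> {a, b} = {}" using \<tau>_edge by blast
    \<comment> \<open>The edge \<open>\<tau>\<close> avoids a, so \<open>other\<close> now forces
      every index in J to be a neighbour of i.\<close>
    then have "i \<noteq> a" using e by auto
    have "c l = 0" if "l \<in> J" "l \<noteq> j" for l
    proof -
      have "l \<in> nbrs D i" using other[OF that(1)] \<open>i \<noteq> a\<close> by blast
      then obtain v' w' where e': "(v', w') \<in> D" "(v', w') = (i, l) \<or> (v', w') = (l, i)"
        by (auto simp: nbrs_def)
      then have "Inr (v', w') \<noteq> \<tau>" using True that(2) e ne by auto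
      then show ?thesis using off_\<tau> that(1) e' by blast
    qed
    then have "(\<Sum>j\<in>J. c j * (p \<otimes>\<^bsub>M t\<^esub> basis_vec (Inl j)) (Inr (v, w))) =
        c j * (p \<otimes>\<^bsub>M t\<^esub> basis_vec (Inl j)) (Inr (v, w))"
      using J j by (intro sum_single_term) auto
    \<comment> \<open>As j is neither a nor b, the term with t is absent and plus or minus the
      coefficient of p at i remains.\<close>
    moreover have "(p \<otimes>\<^bsub>M t\<^esub> basis_vec (Inl j)) (Inr (v, w)) \<noteq> 0"
      using e p ne disj by (auto simp: M_mult_basis)
    ultimately show ?thesis using sum by simp
  qed
qed

text \<open>A nonzero coefficient at i makes the brackets of p with the neighbours of i independent,
  whatever the value of t.\<close>

lemma rank_M_degree:
  assumes "ad_rank_le (M t) r p" "r < card (nbrs D i)"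
  shows "p (Inl i) = 0"
proof (rule ccontr)
  assume p: "p (Inl i) \<noteq> 0"
  have "(\<lambda>j. basis_vec (Inl j)) \<in> nbrs D i \<rightarrow> carrier (M t)"
    using D_sub by (auto simp: nbrs_def intro!: basis_carrier)
  then obtain c where c: "\<exists>j\<in>nbrs D i. c j \<noteq> 0"
      "\<And>k. (\<Sum>j\<in>nbrs D i. c j * (p \<otimes>\<^bsub>M t\<^esub> basis_vec (Inl j)) k) = 0"
    using assms finite_nbrs[of i] unfolding ad_rank_le_def by blast
  have "i \<notin> nbrs D i" using irrefl by (simp add: nbrs_def)
  then have "c j = 0" if "j \<in> nbrs D i" for j
    using neighbour_coefficients_zero[OF p finite_nbrs _ c(2)] that by blast
  then show False using c(1) by blast
qed

text \<open>The vertex b joins the neighbours of a as a test vector. Once their coefficients vanish,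
  the coordinate \<open>\<tau>\<close> forces that of b to vanish too, which gives one independent
  bracket more than deg a.\<close>

lemma rank_M_a:
  assumes "ad_rank_le (M t) (card (nbrs D a)) p" "t \<noteq> 0"
  shows "p (Inl a) = 0"
proof (rule ccontr)
  assume p: "p (Inl a) \<noteq> 0"
  let ?J = "insert b (nbrs D a)"
  have b: "b \<notin> nbrs D a" using ab by (simp add: nbrs_def)
  have "(\<lambda>j. basis_vec (Inl j)) \<in> ?J \<rightarrow> carrier (M t)"
    using D_sub ab by (auto simp: nbrs_def intro!: basis_carrier)
  moreover have "card (nbrs D a) < card ?J" using b finite_nbrs by simp
  moreover have "finite ?J" using finite_nbrs by simp
  ultimately have "\<exists>c. (\<exists>j\<in>?J. c j \<noteq> 0) \<and> (\<forall>k. (\<Sum>j\<in>?J. c j * (p \<otimes>\<^bsub>M t\<^esub> basis_vec (Inl j)) k) = 0)"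
    using assms(1) unfolding ad_rank_le_def by blast
  then obtain c where c: "\<exists>j\<in>?J. c j \<noteq> 0"
      "\<And>k. (\<Sum>j\<in>?J. c j * (p \<otimes>\<^bsub>M t\<^esub> basis_vec (Inl j)) k) = 0" by blast
  have "a \<notin> ?J" using irrefl ab by (simp add: nbrs_def)
  then have c0: "c j = 0" if "j \<in> nbrs D a" for j
    using neighbour_coefficients_zero[OF p _ _ c(2)] that finite_nbrs by simp
  then have "(\<Sum>j\<in>?J. c j * (p \<otimes>\<^bsub>M t\<^esub> basis_vec (Inl j)) \<tau>) = c b * (p \<otimes>\<^bsub>M t\<^esub> basis_vec (Inl b)) \<tau>"
    using finite_nbrs by (intro sum_single_term) auto
  \<comment> \<open>The undeformed bracket contributes nothing at \<open>\<tau>\<close>: it has no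
    vertex coordinates, and an edge target does not contain b.\<close>
  moreover have "(p \<otimes>\<^bsub>M t\<^esub> basis_vec (Inl b)) \<tau> = t * p (Inl a)"
  proof (cases \<tau>)
    case (Inl v)
    then show ?thesis using ab by (simp add: deformed_model_simps wedge_def basis_vec_def)
  next
    case (Inr e)
    then obtain v w where vw: "\<tau> = Inr (v, w)" by (cases e) auto
    then have "(v, w) \<in> D" using \<tau>_mem by auto
    then have "(p \<otimes>\<^bsub>M t\<^esub> basis_vec (Inl b)) (Inr (v, w)) = t * p (Inl a)"
      unfolding M_mult_basis[OF \<open>(v, w) \<in> D\<close>] using vw \<tau>_edge[OF vw] ab by auto
    then show ?thesis unfolding vw[symmetric] .
  qed
  ultimately have "c b = 0" using c(2)[of \<tau>] assms(2) p by simp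
  then show False using c(1) c0 by blast
qed

text \<open>
  An isomorphism would embed the span of the basis vectors of small rank in \<open>M 0\<close> into the span of
  a smaller set of basis vectors of \<open>M t\<close>.
\<close>
lemma deformation_not_isomorphic:
  assumes "t \<noteq> 0"
  shows "\<not> algebra_isomorphic (M 0) (M t)"
proof
  assume "algebra_isomorphic (M 0) (M t)"
  then obtain k where k: "k \<in> alg_hom (M 0) (M t)" and bij: "bij_betw k (carrier (M 0)) (carrier (M t))"
    by (auto simp: algebra_isomorphic_iff)
  let ?r = "card (nbrs D a)"
  \<comment> \<open>H collects the vertices above the threshold. The basis vectors indexed by C,
    among them that of a, have rank at most deg a in \<open>M 0\<close>; their images have no
    coefficient outside R, which lacks a.\<close>
  define H where "H = {v \<in> V. ?r < card (nbrs D v)}"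
  define C where "C = (V <+> D) - Inl ` H"
  define R where "R = (V <+> D) - Inl ` insert a H"
  have fin: "finite C" "finite R" using finite_V finite_D by (auto simp: C_def R_def)
  have "Inl a \<in> C" "R = C - {Inl a}" using ab by (auto simp: C_def R_def H_def)
  then have "card R < card C" using fin by (metis card_Diff1_less)
  \<comment> \<open>Each index in R gives an equation for a vanishing combination of the images, and
    C has one index more than R.\<close>
  from underdetermined_system[OF fin(2,1) this, of "\<lambda>i j. k (basis_vec j) i"]
  obtain c where c: "\<exists>j\<in>C. c j \<noteq> 0" "\<forall>i\<in>R. (\<Sum>j\<in>C. k (basis_vec j) i * c j) = 0" by blast
  have bC: "basis_vec j \<in> carrier (M 0)" if "j \<in> C" for j
    by (rule basis_carrier) (use that in \<open>auto simp: C_def\<close>)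
  have zero: "k (basis_vec j) i = 0" if j: "j \<in> C" and i: "i \<notin> R" for i j
  proof (cases "i \<in> V <+> D")
    case False
    then show ?thesis using alg_hom_closed[OF k bC[OF j]] by (auto simp: deformed_model_simps)
  next
    case True
    then obtain v where v: "i = Inl v" "v \<in> insert a H" using i by (auto simp: R_def)
    have "ad_rank_le (M 0) ?r (basis_vec j)"
    proof (cases j)
      case (Inl w)
      then have "card (nbrs D w) \<le> ?r" using j by (auto simp: C_def H_def)
      \<comment> \<open>A larger bound is tested on fewer families, so the bound deg w may be raised
        to deg a.\<close>
      then show ?thesis using rank_vertex_M0[of w] Inl by (auto simp: ad_rank_le_def)
    next
      case (Inr e)
      show ?thesis unfolding Inr by (rule rank_edge_M0)
    qed
    then have rank: "ad_rank_le (M t) ?r (k (basis_vec j))"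
      by (rule ad_rank_le_iso[OF k bij z_carrier bC[OF j]])
    show ?thesis
      using v(2) rank_M_a[OF rank assms] rank_M_degree[OF rank] unfolding v(1) H_def by blast
  qed
  have "(\<Sum>j\<in>C. c j * k (basis_vec j) i) = 0" for i
    using c(2) zero by (cases "i \<in> R") (auto simp: mult.commute intro!: sum.neutral)
  moreover have "k (\<lambda>i. \<Sum>j\<in>C. c j * basis_vec j i) = (\<lambda>i. \<Sum>j\<in>C. c j * k (basis_vec j) i)"
    using bC by (intro deformed_hom_sum[OF k fin(1)]) auto
  ultimately have "k (\<lambda>i. \<Sum>j\<in>C. c j * basis_vec j i) = (\<lambda>_. 0)" by simp
  also have "\<dots> = k (\<lambda>_. 0)"
    using alg_hom_smult[OF k, of "\<lambda>_. 0" 0] by (simp add: deformed_model_simps)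
  finally have "(\<lambda>i. \<Sum>j\<in>C. c j * basis_vec j i) = (\<lambda>_. 0)"
  proof (rule inj_onD[OF bij_betw_imp_inj_on[OF bij]])
    show "(\<lambda>i. \<Sum>j\<in>C. c j * basis_vec j i) \<in> carrier (M 0)"
      using bC by (auto simp: deformed_model_simps intro!: sum.neutral)
  qed (simp add: deformed_model_simps)
  then have "(\<Sum>j\<in>C. c j * basis_vec j i) = 0" for i by (rule fun_cong)
  moreover have "(\<Sum>j\<in>C. c j * basis_vec j i) = c i" if "i \<in> C" for i
    using that fin by (simp add: basis_vec_def if_distrib sum.delta cong: if_cong)
  ultimately show False using c(1) by auto
qed

end

section \<open>Lines of brackets and open orbits\<close>

lemma algebra_isomorphic_sym:
  assumes A: "complex_algebra A" and iso: "algebra_isomorphic A B"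
  shows "algebra_isomorphic B A"
proof -
  interpret A: complex_algebra A by fact
  obtain f where f: "f \<in> alg_hom A B" and bij: "bij_betw f (carrier A) (carrier B)"
    using iso by (auto simp: algebra_isomorphic_iff)
  let ?g = "inv_into (carrier A) f"
  have g: "?g y \<in> carrier A" "f (?g y) = y" if "y \<in> carrier B" for y
    using that bij by (auto simp: bij_betw_def inv_into_into f_inv_into_f)
  have g_eq: "?g y = x" if "x \<in> carrier A" "f x = y" for x y
    using that bij by (auto simp: bij_betw_def inv_into_f_f)
  have "?g \<in> alg_hom B A"
    by (rule alg_homI) (auto intro!: g_eq simp: g alg_hom_simps[OF f] A.mult_closed)
  then show ?thesis
    using bij_betw_inv_into[OF bij] by (auto simp: algebra_isomorphic_iff)
qed

text \<open>The laws of the product are pulled back along the injective map f; only the linear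
  structure and closure are checked directly.\<close>

lemma complex_algebra_transport:
  assumes vs: "vectorspace complex_field A"
    and closed: "\<And>x y. \<lbrakk>x \<in> carrier A; y \<in> carrier A\<rbrakk> \<Longrightarrow> x \<otimes>\<^bsub>A\<^esub> y \<in> carrier A"
    and B: "complex_algebra B" and f: "f \<in> alg_hom A B" and inj: "inj_on f (carrier A)"
  shows "complex_algebra A"
proof -
  interpret A: vectorspace complex_field A by fact
  interpret B: complex_algebra B by fact
  have smult: "c \<odot>\<^bsub>A\<^esub> x \<in> carrier A" if "x \<in> carrier A" for c x
    using A.smult_closed[of c x] that by (simp add: class_ring_simps)
  show ?thesis
    by (rule complex_algebra.intro[OF vs], unfold_locales)
      (auto intro!: inj_onD[OF inj] closed smult simp: alg_hom_simps[OF f] closed smult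
        B.mult_add_left B.mult_add_right B.mult_smult_left B.mult_smult_right)
qed

section \<open>Brackets on coordinate space and their orbits\<close>

lemma bracket_algebra_simps:
  "carrier (bracket_algebra n \<mu>) = carrier_vec n"
  "x \<otimes>\<^bsub>bracket_algebra n \<mu>\<^esub> y = \<mu> x y"
  "x \<oplus>\<^bsub>bracket_algebra n \<mu>\<^esub> y = x + y"
  "\<zero>\<^bsub>bracket_algebra n \<mu>\<^esub> = 0\<^sub>v n"
  "c \<odot>\<^bsub>bracket_algebra n \<mu>\<^esub> x = c \<cdot>\<^sub>v x"
  by (simp_all add: bracket_algebra_def module_vec_simps)

lemma vectorspace_bracket_algebra: "vectorspace complex_field (bracket_algebra n \<mu>)"
proof -
  interpret V: vectorspace complex_field "module_vec TYPE(complex) n" by (rule vec_vs)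
  have "abelian_group (bracket_algebra n \<mu>)"
    using V.abelian_group_axioms
    by (simp add: bracket_algebra_def abelian_group_def abelian_monoid_def abelian_group_axioms_def)
  then show ?thesis
    using V.vectorspace_axioms
    by (simp add: vectorspace_def Module.module_def module_axioms_def bracket_algebra_def)
qed

text \<open>The polynomials form an inductively generated set of functions, so the univariate
  polynomial is built by the same induction.\<close>

lemma bracket_polynomial_on_line:
  assumes "p \<in> bracket_polynomials n"
    and "\<And>i j k t. \<lbrakk>i < n; j < n; k < n\<rbrakk> \<Longrightarrow>
      \<mu> t (unit_vec n i) (unit_vec n j) $ k = \<alpha> i j k + t * \<beta> i j k"
  shows "\<exists>q. \<forall>t. p (\<mu> t) = poly q t"
  using assms(1)
proof induction
  case (const c)
  show ?case by (rule exI[of _ "[:c:]"]) simp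
next
  case (coord i j k)
  then show ?case by (intro exI[of _ "[:\<alpha> i j k, \<beta> i j k:]"]) (simp add: assms(2))
next
  case (add p q)
  then show ?case by (metis poly_add)
next
  case (mult p q)
  then show ?case by (metis poly_mult)
qed

lemma general_linear_iff:
  "g \<in> general_linear n \<longleftrightarrow> g \<in> carrier_mat n n \<and> (\<exists>h\<in>carrier_mat n n. h * g = 1\<^sub>m n \<and> g * h = 1\<^sub>m n)"
  by (auto simp: general_linear_def Units_def ring_mat_simps)

lemma general_linear_inv:
  assumes "g \<in> general_linear n"
  defines "h \<equiv> inv\<^bsub>complex_mat_ring n\<^esub> g"
  shows "h \<in> carrier_mat n n" "h * g = 1\<^sub>m n" "g * h = 1\<^sub>m n"
proof -
  interpret ring "complex_mat_ring n" by (rule ring_mat)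
  show "h \<in> carrier_mat n n" "h * g = 1\<^sub>m n" "g * h = 1\<^sub>m n"
    using assms Units_inv_closed[of g] Units_l_inv[of g] Units_r_inv[of g]
    by (simp_all add: general_linear_def ring_mat_simps)
qed

lemma gl_action_isomorphic:
  assumes g: "g \<in> general_linear n"
    and \<mu>: "\<And>x y. \<lbrakk>x \<in> carrier_vec n; y \<in> carrier_vec n\<rbrakk> \<Longrightarrow> \<mu> x y \<in> carrier_vec n"
  shows "algebra_isomorphic (bracket_algebra n \<mu>) (bracket_algebra n (gl_action n g \<mu>))"
proof -
  define h where "h = inv\<^bsub>complex_mat_ring n\<^esub> g"
  note h = general_linear_inv[OF g, folded h_def]
  have gc: "g \<in> carrier_mat n n" using g by (simp add: general_linear_iff)
  have hg: "h *\<^sub>v (g *\<^sub>v x) = x" "g *\<^sub>v (h *\<^sub>v x) = x" if "x \<in> carrier_vec n" for x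
    using that h gc by (simp_all flip: assoc_mult_mat_vec)
  have "(\<lambda>x. g *\<^sub>v x) \<in> alg_hom (bracket_algebra n \<mu>) (bracket_algebra n (gl_action n g \<mu>))"
    using gc h(1) \<mu>
    by (intro alg_homI)
      (auto simp: bracket_algebra_simps gl_action_def hg mult_add_distrib_mat_vec mult_mat_vec h_def[symmetric])
  moreover have "bij_betw (\<lambda>x. g *\<^sub>v x) (carrier_vec n) (carrier_vec n)"
    by (rule bij_betw_byWitness[where f' = "\<lambda>x. h *\<^sub>v x"]) (use gc h(1) hg in auto)
  ultimately show ?thesis
    unfolding algebra_isomorphic_iff bracket_algebra_simps by blast
qed

lemma mem_bracket_orbit_self:
  assumes "\<mu> \<in> carrier_vec n \<rightarrow>\<^sub>E carrier_vec n \<rightarrow>\<^sub>E carrier_vec n"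
  shows "\<mu> \<in> bracket_orbit n \<mu>"
proof -
  have one: "1\<^sub>m n \<in> general_linear n" by (auto simp: general_linear_iff)
  have "inv\<^bsub>complex_mat_ring n\<^esub> (1\<^sub>m n) = 1\<^sub>m n"
    using general_linear_inv[OF one] by simp
  \<comment> \<open>For arguments outside the carrier both sides are \<open>undefined\<close> by
    extensionality.\<close>
  then have "gl_action n (1\<^sub>m n) \<mu> x y = \<mu> x y" for x y
    using assms by (auto simp: gl_action_def restrict_def PiE_iff extensional_def)
  then have "gl_action n (1\<^sub>m n) \<mu> = \<mu>" by blast
  then show ?thesis using one unfolding bracket_orbit_def by (metis image_eqI)
qed

lemma not_open_orbit:
  assumes \<mu>: "\<mu> \<in> carrier_vec n \<rightarrow>\<^sub>E carrier_vec n \<rightarrow>\<^sub>E carrier_vec n"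
    and line: "\<And>i j k t. \<lbrakk>i < n; j < n; k < n\<rbrakk> \<Longrightarrow>
      \<nu> t (unit_vec n i) (unit_vec n j) $ k = \<alpha> i j k + t * \<beta> i j k"
    and start: "\<nu> 0 = \<mu>"
    and var: "\<And>t. \<nu> t \<in> nilpotent_brackets n"
    and new: "\<And>t. t \<noteq> 0 \<Longrightarrow> \<not> algebra_isomorphic (bracket_algebra n \<mu>) (bracket_algebra n (\<nu> t))"
  shows "\<not> zariski_open_in_variety n (bracket_orbit n \<mu>)"
proof
  assume "zariski_open_in_variety n (bracket_orbit n \<mu>)"
  then obtain P where P: "P \<subseteq> bracket_polynomials n"
      "bracket_orbit n \<mu> = nilpotent_brackets n - {\<mu>. \<forall>p\<in>P. p \<mu> = 0}"
    by (auto simp: zariski_open_in_variety_def)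
  with mem_bracket_orbit_self[OF \<mu>] obtain p where p: "p \<in> P" "p \<mu> \<noteq> 0" by auto
  obtain q where q: "\<And>t. p (\<nu> t) = poly q t"
    using bracket_polynomial_on_line[of p n \<nu> \<alpha> \<beta>] P(1) p(1) line by blast
  have "q \<noteq> 0" using q[of 0] p(2) start by auto
  \<comment> \<open>Zero is put among the values to avoid, since only for nonzero t does
    \<open>\<nu> t\<close> leave the isomorphism class.\<close>
  then have "finite (insert 0 {t. poly q t = 0})" by (simp add: poly_roots_finite)
  then obtain t where t: "t \<noteq> 0" "poly q t \<noteq> 0"
    using ex_new_if_finite[OF infinite_UNIV_char_0] by blast
  have "p (\<nu> t) \<noteq> 0" using q t(2) by simp
  then have "\<nu> t \<in> bracket_orbit n \<mu>" using P(2) p(1) var[of t] by blast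
  then obtain g where "g \<in> general_linear n" "\<nu> t = gl_action n g \<mu>"
    by (auto simp: bracket_orbit_def)
  then show False
    using gl_action_isomorphic[of g n \<mu>] \<mu> new[OF t(1)] by (auto simp: PiE_iff)
qed

context deformation
begin

text \<open>All \<open>M t\<close> share carrier, sum and scaling. Hence the one linear bijection h
  pulls the whole family back to coordinate space, where it is a line of brackets through
  \<open>\<mu>\<close>.\<close>

lemma not_rigid:
  assumes \<mu>: "\<mu> \<in> nilpotent_brackets n" and iso: "algebra_isomorphic (bracket_algebra n \<mu>) (M 0)"
  shows "\<not> zariski_open_in_variety n (bracket_orbit n \<mu>)"
proof -
  let ?A = "\<lambda>\<mu>. bracket_algebra n \<mu>" and ?V = "carrier_vec n :: complex vec set"
  have \<mu>_ext: "\<mu> \<in> ?V \<rightarrow>\<^sub>E ?V \<rightarrow>\<^sub>E ?V" and "lie_algebra (?A \<mu>)"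
    using \<mu> by (auto simp: nilpotent_brackets_def)
  then have A\<mu>: "complex_algebra (?A \<mu>)" by (simp add: lie_algebra_def)
  obtain h where h: "h \<in> alg_hom (?A \<mu>) (M 0)" and bij: "bij_betw h ?V (carrier (M 0))"
    using iso by (auto simp: algebra_isomorphic_iff bracket_algebra_simps)
  define hi where "hi = inv_into ?V h"
  have carrier_M: "carrier (M t) = carrier (M 0)" for t by (simp add: deformed_model_simps)
  have hc: "h x \<in> carrier (M t)" if "x \<in> ?V" for x t
    using alg_hom_closed[OF h] that by (simp add: bracket_algebra_simps deformed_model_simps)
  have hi: "hi y \<in> ?V" "h (hi y) = y" if "y \<in> carrier (M t)" for y t
    using that bij by (auto simp: hi_def bij_betw_def inv_into_into f_inv_into_f carrier_M[of t])
  have hih: "hi (h x) = x" if "x \<in> ?V" for x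
    using that bij by (auto simp: hi_def bij_betw_def)
  have h_add: "h (x + y) = (\<lambda>i. h x i + h y i)" if "x \<in> ?V" "y \<in> ?V" for x y
    using alg_hom_add[OF h] that by (simp add: bracket_algebra_simps deformed_model_simps)
  have h_smult: "h (c \<cdot>\<^sub>v x) = (\<lambda>i. c * h x i)" if "x \<in> ?V" for c x
    using alg_hom_smult[OF h] that by (simp add: bracket_algebra_simps deformed_model_simps)
  have M_closed: "x \<otimes>\<^bsub>M t\<^esub> y \<in> carrier (M t)" if "x \<in> carrier (M t)" "y \<in> carrier (M t)" for x y t
    using complex_algebra.mult_closed[OF complex_algebra_M] that .
  \<comment> \<open>Both arguments are restricted so that the bracket is extensional, as the variety
    demands.\<close>
  define \<nu> where "\<nu> t = (\<lambda>x\<in>?V. \<lambda>y\<in>?V. hi (h x \<otimes>\<^bsub>M t\<^esub> h y))" for t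
  have \<nu>: "\<nu> t x y = hi (h x \<otimes>\<^bsub>M t\<^esub> h y)" "\<nu> t x y \<in> ?V" if "x \<in> ?V" "y \<in> ?V" for x y t
    using that hi(1)[OF M_closed[OF hc hc]] by (simp_all add: \<nu>_def)
  have h_hom: "h \<in> alg_hom (?A (\<nu> t)) (M t)" for t
  proof (rule alg_homI)
    fix x y assume "x \<in> carrier (?A (\<nu> t))" "y \<in> carrier (?A (\<nu> t))"
    then show "h (x \<otimes>\<^bsub>?A (\<nu> t)\<^esub> y) = h x \<otimes>\<^bsub>M t\<^esub> h y"
      using hi(2)[OF M_closed[OF hc hc]] by (simp add: bracket_algebra_simps \<nu>)
  qed (auto simp: bracket_algebra_simps hc h_add h_smult deformed_model_simps(4,5))
  have bij': "bij_betw h ?V (carrier (M t))" for t using bij by (simp add: carrier_M[of t])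
  have A\<nu>: "complex_algebra (?A (\<nu> t))" for t
    by (rule complex_algebra_transport[OF vectorspace_bracket_algebra _ complex_algebra_M h_hom])
      (use bij' \<nu> in \<open>auto simp: bracket_algebra_simps bij_betw_def\<close>)
  have hi_zero: "hi (\<lambda>_. 0) = 0\<^sub>v n"
    using alg_hom_zero[OF A\<mu> complex_algebra_M h] hih[of "0\<^sub>v n"]
    by (simp add: bracket_algebra_simps deformed_model_simps)
  have var: "\<nu> t \<in> nilpotent_brackets n" for t
  proof -
    interpret N: complex_algebra "?A (\<nu> t)" by (rule A\<nu>)
    have triple: "\<nu> t x (\<nu> t y z) = 0\<^sub>v n" if "x \<in> ?V" "y \<in> ?V" "z \<in> ?V" for x y z
    proof -
      have "h (\<nu> t y z) = h y \<otimes>\<^bsub>M t\<^esub> h z"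
        using that hi(2)[OF M_closed[OF hc hc]] by (simp add: \<nu>)
      then show ?thesis
        using that by (simp add: \<nu>(1)[OF that(1) \<nu>(2)[OF that(2,3)]] M_triple_zero)
          (simp add: deformed_model_simps hi_zero)
    qed
    have self: "\<nu> t x x = 0\<^sub>v n" if "x \<in> ?V" for x
      using that by (simp add: \<nu> deformed_self) (simp add: deformed_model_simps hi_zero)
    have "lie_algebra (?A (\<nu> t))"
      by (rule lie_algebra_of_triple_zero[OF A\<nu>]) (simp_all add: bracket_algebra_simps self triple)
    moreover have "at_most_2_step_nilpotent (?A (\<nu> t))"
      by (simp add: N.at_most_2_step_iff bracket_algebra_simps triple)
    moreover have "\<nu> t \<in> ?V \<rightarrow>\<^sub>E ?V \<rightarrow>\<^sub>E ?V"
      using \<nu>(2) by (auto simp: \<nu>_def PiE_iff extensional_def)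
    ultimately show ?thesis by (simp add: nilpotent_brackets_def)
  qed
  have start: "\<nu> 0 = \<mu>"
  proof -
    have "\<nu> 0 x y = \<mu> x y" if "x \<in> ?V" "y \<in> ?V" for x y
    proof -
      have eq: "h (\<mu> x y) = h x \<otimes>\<^bsub>M 0\<^esub> h y" and "\<mu> x y \<in> ?V"
        using alg_hom_mult[OF h, of x y] \<mu>_ext that by (auto simp: bracket_algebra_simps PiE_iff)
      then show ?thesis unfolding \<nu>(1)[OF that] eq[symmetric] by (intro hih)
    qed
    then have "\<nu> 0 x y = \<mu> x y" for x y
      using \<mu>_ext unfolding \<nu>_def
      by (cases "x \<in> ?V"; cases "y \<in> ?V") (auto simp: PiE_iff extensional_def)
    then show ?thesis by blast
  qed
  \<comment> \<open>The coordinate vector of \<open>\<tau>\<close> brought back by h; it spans the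
    values of the direction of the line.\<close>
  define e where "e = hi (basis_vec \<tau>)"
  have basis_\<tau>: "basis_vec \<tau> \<in> carrier (M 0)" by (rule basis_carrier[OF \<tau>_mem])
  have line: "\<nu> t x y = \<mu> x y + t \<cdot>\<^sub>v (wedge (h x) (h y) a b \<cdot>\<^sub>v e)" if "x \<in> ?V" "y \<in> ?V" for x y t
  proof -
    have e: "e \<in> ?V" "h e = basis_vec \<tau>" using hi[OF basis_\<tau>] by (simp_all add: e_def)
    have m: "\<mu> x y \<in> ?V" using \<mu>_ext that by (auto simp: PiE_iff)
    have "h (\<mu> x y) = h x \<otimes>\<^bsub>M 0\<^esub> h y"
      using alg_hom_mult[OF h, of x y] that by (simp add: bracket_algebra_simps)
    \<comment> \<open>The comparison takes place after applying h, where the product of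
      \<open>M t\<close> is that of \<open>M 0\<close> plus a multiple of the basis vector at
      \<open>\<tau>\<close>.\<close>
    then have "h (\<mu> x y + t \<cdot>\<^sub>v (wedge (h x) (h y) a b \<cdot>\<^sub>v e)) = h x \<otimes>\<^bsub>M t\<^esub> h y"
      using m e by (simp add: h_add h_smult) (auto simp: deformed_model_simps basis_vec_def)
    then show ?thesis
      using that hih[of "\<mu> x y + t \<cdot>\<^sub>v (wedge (h x) (h y) a b \<cdot>\<^sub>v e)"] m e by (simp add: \<nu>(1))
  qed
  show ?thesis
  proof (rule not_open_orbit[where \<nu> = \<nu> and \<alpha> = "\<lambda>i j k. \<mu> (unit_vec n i) (unit_vec n j) $ k"
        and \<beta> = "\<lambda>i j k. wedge (h (unit_vec n i)) (h (unit_vec n j)) a b * e $ k", OF \<mu>_ext _ start var])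
    fix i j k :: nat and t assume ijk: "i < n" "j < n" "k < n"
    have "e \<in> ?V" using hi[OF basis_\<tau>] by (simp add: e_def)
    then show "\<nu> t (unit_vec n i) (unit_vec n j) $ k = \<mu> (unit_vec n i) (unit_vec n j) $ k +
        t * (wedge (h (unit_vec n i)) (h (unit_vec n j)) a b * e $ k)"
      using ijk by (simp add: line)
  next
    fix t :: complex assume t: "t \<noteq> 0"
    show "\<not> algebra_isomorphic (?A \<mu>) (?A (\<nu> t))"
    proof
      assume "algebra_isomorphic (?A \<mu>) (?A (\<nu> t))"
      moreover have "algebra_isomorphic (?A (\<nu> t)) (M t)"
        using h_hom bij' by (auto simp: algebra_isomorphic_iff bracket_algebra_simps)
      ultimately have "algebra_isomorphic (M 0) (M t)"
        using algebra_isomorphic_sym[OF A\<mu> iso] by (meson algebra_isomorphic_trans)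
      then show False using deformation_not_isomorphic[OF t] by blast
    qed
  qed
qed

end

section \<open>Choice of the non-edge and conclusion\<close>

lemma doubletons_iff: "e \<in> nsets V 2 \<longleftrightarrow> (\<exists>x y. e = {x, y} \<and> x \<in> V \<and> y \<in> V \<and> x \<noteq> y)"
  by (auto simp: nsets_def card_2_iff)

text \<open>If the given edge and non-edge meet, they cover at most three vertices. Two further
  vertices x and y remain: they form either an edge disjoint from ab or a non-edge disjoint from
  cd.\<close>

lemma disjoint_nonedge_edge:
  assumes E: "E \<subseteq> nsets V 2" and V: "finite V" "card V > 4"
    and ab: "a \<in> V" "b \<in> V" "a \<noteq> b" "{a, b} \<notin> E" and e: "e \<in> E"
  obtains a' b' c d where "a' \<in> V" "b' \<in> V" "a' \<noteq> b'" "{a', b'} \<notin> E" "{c, d} \<in> E" "{a', b'} \<inter> {c, d} = {}"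
proof -
  have cv: "finite e" "card e = 2" "e \<subseteq> V" using E e by (auto simp: nsets_def)
  then obtain c d where cd: "e = {c, d}" "c \<noteq> d" by (auto simp: card_2_iff)
  show thesis
  proof (cases "{a, b} \<inter> {c, d} = {}")
    case True
    then show thesis using that[of a b c d] ab e cd by blast
  next
    case False
    have "e \<noteq> {a, b}" using ab e by blast
    then have "card (e \<union> {a, b}) \<le> 3"
      using False cd ab by (auto simp: card_insert_if)
    then have "card (V - (e \<union> {a, b})) \<ge> 2"
      using V cv ab by (subst card_Diff_subset) auto
    then obtain F where "F \<subseteq> V - (e \<union> {a, b})" "card F = 2"
      by (meson obtain_subset_with_card_n)
    then obtain x y where xy: "x \<noteq> y" "x \<in> V" "y \<in> V" "{x, y} \<inter> (e \<union> {a, b}) = {}"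
      by (auto simp: card_2_iff)
    show thesis
    proof (cases "{x, y} \<in> E")
      case True
      then show thesis using that[of a b x y] ab xy by blast
    next
      case False
      then show thesis using that[of x y c d] e cd xy by blast
    qed
  qed
qed

theorem theorem4p1:
  fixes V :: "'v set" and E :: "'v set set"
  assumes "simple_graph V E" and "card V > 4" and "\<not> complete_graph V E"
  shows "\<not> two_rigid (graph_lie_algebra V E)"
proof
  assume "two_rigid (graph_lie_algebra V E)"
  then obtain n \<mu> where \<mu>: "algebra_isomorphic (bracket_algebra n \<mu>) (graph_lie_algebra V E)"
      "\<mu> \<in> nilpotent_brackets n" "zariski_open_in_variety n (bracket_orbit n \<mu>)"
    by (auto simp: two_rigid_def two_rigid_bracket_def)
  have V: "finite V" and E: "E \<subseteq> nsets V 2" using assms(1) by (auto simp: simple_graph_def)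
  \<comment> \<open>The vertices carry no order; a numbering orients each edge in exactly one
    way.\<close>
  obtain \<iota> :: "'v \<Rightarrow> nat" where \<iota>: "inj_on \<iota> V"
    using finite_imp_inj_to_nat_seg[OF V] by blast
  define D where "D = {(v, w) \<in> V \<times> V. \<iota> v < \<iota> w \<and> {v, w} \<in> E}"
  have D_sub: "D \<subseteq> V \<times> V" and D_asym: "\<And>v w. (v, w) \<in> D \<Longrightarrow> (w, v) \<notin> D"
    and D_edge: "\<And>v w. (v, w) \<in> D \<Longrightarrow> {v, w} \<in> E" by (auto simp: D_def)
  have D_mem: "(v, w) \<in> D \<or> (w, v) \<in> D" if "{v, w} \<in> E" for v w
  proof -
    have vw: "v \<in> V" "w \<in> V" "v \<noteq> w"
      using E that by (auto simp: doubletons_iff doubleton_eq_iff dest!: subsetD)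
    then have "\<iota> v \<noteq> \<iota> w" using \<iota> by (auto simp: inj_on_def)
    then show ?thesis using vw that by (auto simp: D_def insert_commute)
  qed
  have E_D: "E = {{v, w} | v w. (v, w) \<in> D}"
  proof
    show "E \<subseteq> {{v, w} | v w. (v, w) \<in> D}"
    proof
      fix e assume e: "e \<in> E"
      then obtain v w where "e = {v, w}" using E by (auto simp: doubletons_iff dest!: subsetD)
      then show "e \<in> {{v, w} | v w. (v, w) \<in> D}"
        using D_mem[of v w] e by (auto simp: insert_commute)
    qed
  qed (use D_edge in auto)
  obtain a0 b0 where ab0: "a0 \<in> V" "b0 \<in> V" "a0 \<noteq> b0" "{a0, b0} \<notin> E"
  proof -
    obtain e where "e \<in> nsets V 2" "e \<notin> E" using assms(3) E by (auto simp: complete_graph_def)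
    then show thesis using that by (auto simp: doubletons_iff)
  qed
  have "\<exists>a b \<tau>. deformation V D a b \<tau>"
  proof (cases "E = {}")
    case True
    then have "D = {}" using D_edge by fast
    have "\<not> V \<subseteq> {a0, b0}"
      using assms(2) card_mono[of "{a0, b0}" V] ab0 by auto
    then obtain v where "v \<in> V" "v \<notin> {a0, b0}" by blast
    \<comment> \<open>Without edges every vertex is isolated, so any third vertex is an admissible
      target.\<close>
    then have "deformation V D a0 b0 (Inl v)"
      using V ab0 \<open>D = {}\<close> by unfold_locales auto
    then show ?thesis by blast
  next
    case False
    then obtain e where "e \<in> E" by blast
    then obtain a b c d where abcd: "a \<in> V" "b \<in> V" "a \<noteq> b" "{a, b} \<notin> E" "{c, d} \<in> E"
        "{a, b} \<inter> {c, d} = {}"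
      using disjoint_nonedge_edge[OF E V assms(2) ab0] by metis
    \<comment> \<open>The model has a coordinate for the edge cd only in the orientation that
      belongs to D.\<close>
    obtain x y where xy: "(x, y) \<in> D" "{x, y} = {c, d}"
      using D_mem[OF abcd(5)] by (auto simp: insert_commute)
    have "(a, b) \<notin> D" "(b, a) \<notin> D" using D_edge[of a b] D_edge[of b a] abcd(4)
      by (auto simp: insert_commute)
    then have "deformation V D a b (Inr (x, y))"
      using V abcd xy D_sub D_asym by unfold_locales auto
    then show ?thesis by blast
  qed
  then obtain a b \<tau> where "deformation V D a b \<tau>" by blast
  then interpret deformation V D a b \<tau> .
  have "algebra_isomorphic (bracket_algebra n \<mu>) (M 0)"
    unfolding M_0
    using algebra_isomorphic_trans[OF \<mu>(1)] graph_lie_algebra_iso[OF V D_sub D_asym] unfolding E_D by blast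
  then show False using not_rigid[OF \<mu>(2)] \<mu>(3) by blast
qed

end
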